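(* Let $q,d\in\mathbb N$, $T>0$, $\theta\ge 0$, let $\|\cdot\|$ be a fixed norm on $\mathbb R^d$, and let $R\ge 0$ be an arbitrary measurement variance. Consider the Gaussian ODE filter (defined in the context) with $q$ modelled derivatives, drift parameter $\theta$ and step size $h$, applied to $\dot x(t)=f(x(t))$ on $[0,T]$, $x(0)=x_0\in\mathbb R^d$. Assume: (A1) $f\in C^q(\mathbb R^d;\mathbb R^d)$ and there is $L>0$ with $\|D^\alpha f\|_\infty\le L$ for all multi-indices $\alpha\in\mathbb N_0^d$ with $1\le\sum_i\alpha_i\le q$, and $\|D^\alpha f(a)-D^\alpha f(b)\|\le L\|a-b\|$ for all $a,b\in\mathbb R^d$ and all $\alpha$ with $0\le\sum_i\alpha_i\le q$. (A2) The initial covariance matrices satisfy $\|P(0)_{k,l}\|\le K_0h^{2q+1-k-l}$ for all $k,l\in\{0,\dots,q\}$. (A3) The initial means satisfy $\|m^{(i)}(0)-x^{(i)}(0)\|\le K_0h^{q+1-i}$ for all $i\in\{0,\dots,q\}$. Here $K_0>0$ is a constant independent of $h$ (the initial values $\boldsymbol m(0)$ and $P(0)$ may depend on $h$). Then there is a constant $K>0$, independent of $h$ and $\theta$, such that for all sufficiently small $h>0$ $$\left\|\varepsilon^{(0)}(h)\right\|\le |||\boldsymbol\varepsilon(h)|||_h\le K\left[1+\theta\left\|m^{(q)}(0)\right\|\right]h^{q+1}.$$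
   Context: Indices start at $0$. The exact solution is $x=x^{(0)}$, $x^{(i)}=\frac{d^ix}{dt^i}$, and $\boldsymbol x=(x^{(0)},\dots,x^{(q)})^\intercal\in\mathbb R^{(q+1)\times d}$ (row $i$ is $x^{(i)}(t)\in\mathbb R^d$). "For all sufficiently small $h$" is understood with all other data ($f,x_0,T,q,d,\theta$, the scales $\sigma_j$, $K_0$, the norm) fixed. Prior matrices. Let $F\in\mathbb R^{(q+1)\times(q+1)}$ have entries $F_{i,i+1}=1$ for $0\le i\le q-1$, $F_{q,q}=-\theta$, and all other entries $0$. For each coordinate $j\in\{0,\dots,d-1\}$ fix a scale $\sigma_j>0$, let $\ell_j=(0,\dots,0,\sigma_j)^\intercal\in\mathbb R^{q+1}$, and put $$A(h)=\exp(hF),\qquad Q_j(h)=\int_0^h \exp(F(h-\tau))\,\ell_j\ell_j^\intercal\exp(F(h-\tau))^\intercal\,d\tau .$$ ($\theta=0$: $q$-times integrated Brownian motion prior; $\theta>0$: $q$-times integrated Ornstein–Uhlenbeck prior.) Filter. The state at time $t=nh$ is a mean $\boldsymbol m(t)=(m^{(0)}(t),\dots,m^{(q)}(t))^\intercal\in\mathbb R^{(q+1)\times d}$ with rows $m^{(i)}(t)\in\mathbb R^d$, together with a symmetric positive semidefinite matrix $P_j(t)\in\mathbb R^{(q+1)\times(q+1)}$ for each coordinate $j$. $P(t)_{k,l}\in\mathbb R^d$ denotes the vector with components $(P_j(t))_{k,l}$. One step $t\to t+h$ is: prediction $\boldsymbol m^-(t+h)=A(h)\boldsymbol m(t)$ and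 $P_j^-(t+h)=A(h)P_j(t)A(h)^\intercal+Q_j(h)$; residual $r(t+h)=f(m^{-,(0)}(t+h))-m^{-,(1)}(t+h)\in\mathbb R^d$; gains $\beta_j^{(i)}(t+h)=\dfrac{(P^-_j(t+h))_{i1}}{(P_j^-(t+h))_{11}+R(t+h)}$, $i=0,\dots,q$, where $R(t+h)\ge0$; update $m^{(i)}_j(t+h)=m_j^{-,(i)}(t+h)+\beta_j^{(i)}(t+h)r_j(t+h)$ and $$P_j(t+h)=P_j^-(t+h)-\frac{(P_j^-(t+h))_{:,1}(P_j^-(t+h))_{1,:}}{(P_j^-(t+h))_{11}+R(t+h)} .$$ Error and norm. $\boldsymbol\varepsilon(nh)=(\varepsilon^{(0)}(nh),\dots,\varepsilon^{(q)}(nh))^\intercal:=\boldsymbol m(nh)-\boldsymbol x(nh)$, and for $a\in\mathbb R^{(q+1)\times d}$ with rows $a_{i,:}$, $|||a|||_h:=\sum_{i=0}^q h^i\|a_{i,:}\|$. *)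

theory Defs
  imports "HOL-Analysis.Analysis" "Jordan_Normal_Form.Matrix"
begin

definition is_norm :: "('a::real_vector \<Rightarrow> real) \<Rightarrow> bool" where
  "is_norm N \<longleftrightarrow>
     (\<forall>a. N a = 0 \<longrightarrow> a = 0) \<and>
     (\<forall>c a. N (c *\<^sub>R a) = \<bar>c\<bar> * N a) \<and>
     (\<forall>a b. N (a + b) \<le> N a + N b)"

definition partial_deriv :: "'d::finite \<Rightarrow> (real^'d \<Rightarrow> real^'d) \<Rightarrow> real^'d \<Rightarrow> real^'d" where
  "partial_deriv j g a = vector_derivative (\<lambda>s. g (a + s *\<^sub>R axis j 1)) (at 0)"

text \<open>Class $C^k$ on the whole space: all iterated partial derivatives up to order $k$, taken in
  any order, exist and are continuous.\<close>
primrec Ck :: "nat \<Rightarrow> (real^'d::finite \<Rightarrow> real^'d) \<Rightarrow> bool" where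
  "Ck 0 g \<longleftrightarrow> continuous_on UNIV g"
| "Ck (Suc k) g \<longleftrightarrow> continuous_on UNIV g \<and>
     (\<forall>j. (\<forall>a. (\<lambda>s. g (a + s *\<^sub>R axis j 1)) differentiable (at (0::real))) \<and> Ck k (partial_deriv j g))"

text \<open>$D^\alpha g = \partial_0^{\alpha_0} \cdots \partial_{d-1}^{\alpha_{d-1}} g$ for a multi-index
  $\alpha$; the linear order on the finite index type enumerates the coordinates.\<close>
definition multi_deriv ::
  "('d::{finite,linorder} \<Rightarrow> nat) \<Rightarrow> (real^'d::_ \<Rightarrow> real^'d::_) \<Rightarrow> real^'d::_ \<Rightarrow> real^'d::_" where
  "multi_deriv \<alpha> g = foldr (\<lambda>j. partial_deriv j ^^ \<alpha> j) (sorted_list_of_set UNIV) g"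

text \<open>$i$-th time derivative on $[0,T]$, one-sided at the end points.\<close>
definition time_deriv :: "real \<Rightarrow> nat \<Rightarrow> (real \<Rightarrow> 'a::real_normed_vector) \<Rightarrow> real \<Rightarrow> 'a" where
  "time_deriv T i x = ((\<lambda>y t. vector_derivative y (at t within {0..T})) ^^ i) x"

definition mat_exp :: "real mat \<Rightarrow> real mat" where
  "mat_exp M = Matrix.mat (dim_row M) (dim_row M) (\<lambda>(i,j). \<Sum>n. (M ^\<^sub>m n) $$ (i,j) / fact n)"

definition drift_mat :: "nat \<Rightarrow> real \<Rightarrow> real mat" where
  "drift_mat q \<theta> = Matrix.mat (q+1) (q+1)
     (\<lambda>(i,j). if j = i + 1 then 1 else if i = q \<and> j = q then - \<theta> else 0)"

text \<open>The vector $\ell = (0,\dots,0,s)^\intercal$ as a one-column matrix.\<close>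
definition scale_col :: "nat \<Rightarrow> real \<Rightarrow> real mat" where
  "scale_col q s = Matrix.mat (q+1) 1 (\<lambda>(i,_). if i = q then s else 0)"

definition trans_mat :: "nat \<Rightarrow> real \<Rightarrow> real \<Rightarrow> real mat" where
  "trans_mat q \<theta> h = mat_exp (h \<cdot>\<^sub>m drift_mat q \<theta>)"

definition noise_mat :: "nat \<Rightarrow> real \<Rightarrow> real \<Rightarrow> real \<Rightarrow> real mat" where
  "noise_mat q \<theta> s h = Matrix.mat (q+1) (q+1) (\<lambda>(k,l).
     integral {0..h} (\<lambda>\<tau>.
       (mat_exp ((h - \<tau>) \<cdot>\<^sub>m drift_mat q \<theta>) * (scale_col q s * transpose_mat (scale_col q s))
          * transpose_mat (mat_exp ((h - \<tau>) \<cdot>\<^sub>m drift_mat q \<theta>))) $$ (k,l)))"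

definition sym_psd :: "nat \<Rightarrow> real mat \<Rightarrow> bool" where
  "sym_psd n P \<longleftrightarrow> P \<in> carrier_mat n n \<and> transpose_mat P = P \<and>
     (\<forall>v \<in> carrier_vec n. 0 \<le> scalar_prod v (P *\<^sub>v v))"

text \<open>A mean is given by its rows \<open>m i\<close>, only \<open>i \<le> q\<close> being meaningful; the second component
  holds one covariance matrix per coordinate.\<close>
type_synonym 'd filter_state = "(nat \<Rightarrow> real^'d) \<times> ('d \<Rightarrow> real mat)"

definition predict_mean :: "nat \<Rightarrow> real \<Rightarrow> real \<Rightarrow> (nat \<Rightarrow> real^'d) \<Rightarrow> nat \<Rightarrow> real^'d::finite" where
  "predict_mean q \<theta> h m i = (\<Sum>k\<le>q. trans_mat q \<theta> h $$ (i,k) *\<^sub>R m k)"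

definition predict_cov :: "nat \<Rightarrow> real \<Rightarrow> real \<Rightarrow> real \<Rightarrow> real mat \<Rightarrow> real mat" where
  "predict_cov q \<theta> s h P =
     trans_mat q \<theta> h * P * transpose_mat (trans_mat q \<theta> h) + noise_mat q \<theta> s h"

definition gain :: "real \<Rightarrow> real mat \<Rightarrow> nat \<Rightarrow> real" where
  "gain \<rho> Pm i = Pm $$ (i,1) / (Pm $$ (1,1) + \<rho>)"

definition update_cov :: "nat \<Rightarrow> real \<Rightarrow> real mat \<Rightarrow> real mat" where
  "update_cov q \<rho> Pm = Matrix.mat (q+1) (q+1)
     (\<lambda>(k,l). Pm $$ (k,l) - Pm $$ (k,1) * Pm $$ (1,l) / (Pm $$ (1,1) + \<rho>))"

text \<open>One step; \<open>\<rho>\<close> is the measurement variance at the new time.\<close>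
definition filter_step ::
  "nat \<Rightarrow> real \<Rightarrow> ('d::finite \<Rightarrow> real) \<Rightarrow> (real^'d \<Rightarrow> real^'d) \<Rightarrow> real \<Rightarrow> real \<Rightarrow>
     'd filter_state \<Rightarrow> 'd filter_state" where
  "filter_step q \<theta> \<sigma> f h \<rho> S =
     (let mm = predict_mean q \<theta> h (fst S);
          Pm = (\<lambda>j. predict_cov q \<theta> (\<sigma> j) h (snd S j));
          r = f (mm 0) - mm 1
      in (\<lambda>i. \<chi> j. vec_nth (mm i) j + gain \<rho> (Pm j) i * vec_nth r j,
          \<lambda>j. update_cov q \<rho> (Pm j)))"

text \<open>The filter state at time $nh$.\<close>
primrec ode_filter ::
  "nat \<Rightarrow> real \<Rightarrow> ('d::finite \<Rightarrow> real) \<Rightarrow> (real^'d \<Rightarrow> real^'d) \<Rightarrow> (real \<Rightarrow> real) \<Rightarrow> real \<Rightarrow>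
     'd filter_state \<Rightarrow> nat \<Rightarrow> 'd filter_state" where
  "ode_filter q \<theta> \<sigma> f R h S 0 = S"
| "ode_filter q \<theta> \<sigma> f R h S (Suc n) =
     filter_step q \<theta> \<sigma> f h (R (real (Suc n) * h)) (ode_filter q \<theta> \<sigma> f R h S n)"

text \<open>Row $i$ of the error at time $nh$, where \<open>x\<close> is the exact solution on $[0,T]$.\<close>
definition filter_error ::
  "nat \<Rightarrow> real \<Rightarrow> ('d::finite \<Rightarrow> real) \<Rightarrow> (real^'d \<Rightarrow> real^'d) \<Rightarrow> (real \<Rightarrow> real) \<Rightarrow> real \<Rightarrow>
     'd filter_state \<Rightarrow> real \<Rightarrow> (real \<Rightarrow> real^'d) \<Rightarrow> nat \<Rightarrow> nat \<Rightarrow> real^'d" where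
  "filter_error q \<theta> \<sigma> f R h S T x n i =
     fst (ode_filter q \<theta> \<sigma> f R h S n) i - time_deriv T i x (real n * h)"

definition h_norm :: "nat \<Rightarrow> ('a \<Rightarrow> real) \<Rightarrow> real \<Rightarrow> (nat \<Rightarrow> 'a) \<Rightarrow> real" where
  "h_norm q N h a = (\<Sum>i\<le>q. h ^ i * N (a i))"

end

theory Submission
  imports Defs
begin

text \<open>On the last column \<open>trans_mat\<close> differs from the Taylor coefficients
  $h^{q-i}/(q-i)!$ by at most $3\theta h^{q+1-i}$ and elsewhere it equals them, so the prediction
  error of row $i$ consists of the Taylor remainder of $x$, the propagated initial error and a term
  of size $\theta h^{q+1-i}$ times the norm of $m^{(q)}(0)$. The noise gives
  $P^-_{11} \ge c\,h^{2q-1}$ once $\theta h$ is small, with $c$ independent of $\theta$, while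
  $P^-_{i1} = O(h^{2q-i})$; hence the gains are $O(h^{1-i})$ for every $R \ge 0$ and the
  correction preserves the order of the prediction.\<close>

subsection \<open>Smoothness of the exact solution\<close>

text \<open>The obstacle is the order of the quantifiers: \<open>K\<close> is chosen before theta,
  while the admissible step sizes may depend on theta. Drift terms are therefore estimated under
  \<open>6 * fact (q - 1) * (\<theta> * h) \<le> 1\<close>, which turns powers of theta * h into
  absolute numbers; the one factor theta that survives multiplies m^(q)(0). The lower bound on the
  denominator of the gain has to come from the noise alone: (A2) bounds P(0) only from above and
  admits P(0) = 0, so the propagated covariance contributes no more than a nonnegative quadratic
  form. The gains differ between coordinates, and coordinatewise multiplication is monotone in the
  Euclidean norm but not in every norm. All estimates are therefore Euclidean, and the equivalence
  of norms is applied to the data beforehand and to the error at the end. The Taylor remainder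
  involves q+1 derivatives of x although f has only q; the missing one is gained from the
  equation.\<close>

text \<open>Class C^k on [0,T] with one-sided derivatives at the ends. The derivative is an
  existential witness, so sums, products and compositions are handled by induction without formulas
  for iterated derivatives.\<close>

primrec diff_on :: "real \<Rightarrow> nat \<Rightarrow> (real \<Rightarrow> 'a::real_normed_vector) \<Rightarrow> bool" where
  "diff_on T 0 y \<longleftrightarrow> continuous_on {0..T} y"
| "diff_on T (Suc k) y \<longleftrightarrow>
     (\<exists>y'. (\<forall>t\<in>{0..T}. (y has_vector_derivative y' t) (at t within {0..T})) \<and> diff_on T k y')"

lemma diff_on_cong:
  assumes "diff_on T k y" "\<And>t. t \<in> {0..T} \<Longrightarrow> z t = y t"
  shows "diff_on T k z"
proof (cases k)
  case 0
  then show ?thesis using assms by (metis continuous_on_cong diff_on.simps(1))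
next
  case (Suc n)
  then obtain y' where y': "\<forall>t\<in>{0..T}. (y has_vector_derivative y' t) (at t within {0..T})"
    "diff_on T n y'" using assms by auto
  have "\<forall>t\<in>{0..T}. (z has_vector_derivative y' t) (at t within {0..T})"
    using y' assms(2) by (blast intro: has_vector_derivative_transform)
  with y' Suc show ?thesis by auto
qed

lemma diff_on_SucI:
  assumes "\<And>t. t \<in> {0..T} \<Longrightarrow> (y has_vector_derivative y' t) (at t within {0..T})" "diff_on T k y'"
  shows "diff_on T (Suc k) y"
  unfolding diff_on.simps by (intro exI[of _ y'] conjI ballI assms)

lemma diff_on_Suc_lower: "diff_on T (Suc k) y \<Longrightarrow> diff_on T k y"
proof (induction k arbitrary: y)
  case 0
  then show ?case by (auto intro: continuous_on_vector_derivative)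
next
  case (Suc k)
  then obtain y' where "\<forall>t\<in>{0..T}. (y has_vector_derivative y' t) (at t within {0..T})"
    "diff_on T (Suc k) y'" by (metis diff_on.simps(2))
  with Suc.IH show ?case by auto
qed

lemma diff_on_add:
  "diff_on T k y \<Longrightarrow> diff_on T k z \<Longrightarrow> diff_on T k (\<lambda>t. y t + z t)"
proof (induction k arbitrary: y z)
  case 0
  then show ?case by (auto intro: continuous_intros)
next
  case (Suc k)
  then obtain y' z' where
    "\<forall>t\<in>{0..T}. (y has_vector_derivative y' t) (at t within {0..T})" "diff_on T k y'"
    "\<forall>t\<in>{0..T}. (z has_vector_derivative z' t) (at t within {0..T})" "diff_on T k z'"
    by auto
  then show ?case using Suc.IH[of y' z']
    by (auto intro!: exI[of _ "\<lambda>t. y' t + z' t"] has_vector_derivative_add)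
qed

lemma diff_on_zero: "diff_on T k (\<lambda>t. 0)"
  by (induction k) (auto intro!: exI[of _ "\<lambda>t. 0"])

lemma diff_on_sum:
  "finite I \<Longrightarrow> (\<And>i. i \<in> I \<Longrightarrow> diff_on T k (y i)) \<Longrightarrow> diff_on T k (\<lambda>t. \<Sum>i\<in>I. y i t)"
  by (induction I rule: finite_induct) (auto intro: diff_on_add diff_on_zero)

lemma diff_on_bounded_linear:
  assumes "bounded_linear g"
  shows "diff_on T k y \<Longrightarrow> diff_on T k (\<lambda>t. g (y t))"
proof (induction k arbitrary: y)
  case 0
  then show ?case using assms by (auto intro: bounded_linear.continuous_on)
next
  case (Suc k)
  then obtain y' where
    "\<forall>t\<in>{0..T}. (y has_vector_derivative y' t) (at t within {0..T})" "diff_on T k y'" by auto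
  then show ?case using Suc.IH[of y'] bounded_linear.has_vector_derivative[OF assms]
    by (auto intro!: exI[of _ "\<lambda>t. g (y' t)"])
qed

lemma diff_on_scaleR:
  fixes y :: "real \<Rightarrow> real"
  shows "diff_on T k y \<Longrightarrow> diff_on T k z \<Longrightarrow> diff_on T k (\<lambda>t. y t *\<^sub>R z t)"
proof (induction k arbitrary: y z)
  case 0
  then show ?case by (auto intro: continuous_intros)
next
  case (Suc k)
  then obtain y' z' where
    "\<forall>t\<in>{0..T}. (y has_vector_derivative y' t) (at t within {0..T})" "diff_on T k y'"
    "\<forall>t\<in>{0..T}. (z has_vector_derivative z' t) (at t within {0..T})" "diff_on T k z'"
    by auto
  \<comment> \<open>Each term of the product rule leaves one factor undifferentiated, so both
    factors are needed one class lower as well.\<close>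
  moreover have "diff_on T k y" "diff_on T k z"
    using Suc.prems by (blast intro: diff_on_Suc_lower)+
  ultimately show ?case using Suc.IH[of y z'] Suc.IH[of y' z]
    by (auto intro!: exI[of _ "\<lambda>t. y t *\<^sub>R z' t + y' t *\<^sub>R z t"] diff_on_add
        bounded_bilinear.has_vector_derivative[OF bounded_bilinear_scaleR])
qed

section \<open>Chain rule for C^k vector fields and regularity of solutions\<close>

text \<open>\<open>Ck\<close> speaks of the derivative at parameter 0 only, but for every base
  point; moving the base point along the axis gives it at every parameter.\<close>

lemma Ck_Suc_has_partial:
  assumes "Ck (Suc k) g"
  shows "((\<lambda>s. g (a + s *\<^sub>R axis j 1)) has_vector_derivative partial_deriv j g (a + s *\<^sub>R axis j 1)) (at s)"
proof -
  define b where "b = a + s *\<^sub>R axis j (1::real)"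
  have "((\<lambda>r. g (b + r *\<^sub>R axis j 1)) has_vector_derivative partial_deriv j g b) (at 0)"
    using assms unfolding partial_deriv_def vector_derivative_works[symmetric] by auto
  then have "((\<lambda>r. g (b + r *\<^sub>R axis j 1)) \<circ> (\<lambda>r. r - s) has_vector_derivative
      1 *\<^sub>R partial_deriv j g b) (at s)"
    by (intro vector_diff_chain_at) (auto intro!: derivative_eq_intros)
  moreover have "(\<lambda>r. g (b + r *\<^sub>R axis j 1)) \<circ> (\<lambda>r. r - s) = (\<lambda>r. g (a + r *\<^sub>R axis j 1))"
    by (auto simp: b_def algebra_simps scaleR_left_diff_distrib)
  ultimately show ?thesis by (simp add: b_def)
qed

lemma Ck_imp_continuous_on: "Ck k g \<Longrightarrow> continuous_on UNIV g"
  by (cases k) auto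

text \<open>Moving from \<open>a\<close> to \<open>a + v\<close> one coordinate at a time reduces total
  differentiability to the mean value inequality along the axes.\<close>
lemma Ck_Suc_has_derivative:
  fixes g :: "real^'d::finite \<Rightarrow> real^'d"
  assumes "Ck (Suc k) g"
  shows "(g has_derivative (\<lambda>v. \<Sum>j\<in>UNIV. vec_nth v j *\<^sub>R partial_deriv j g a)) (at a)"
  unfolding has_derivative_at_alt
proof (intro conjI allI impI)
  show "bounded_linear (\<lambda>v. \<Sum>j\<in>UNIV. vec_nth v j *\<^sub>R partial_deriv j g a)"
    by (intro bounded_linear_sum bounded_linear_compose[OF bounded_linear_scaleR_left] bounded_linear_vec_nth)
next
  fix e :: real assume "e > 0"
  \<comment> \<open>One share of \<open>e\<close> per coordinate: the errors of the CARD('d) axis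
    moves add up to \<open>e * norm v\<close>.\<close>
  define c where "c = e / real CARD('d)"
  have "c > 0" using \<open>e > 0\<close> by (simp add: c_def)
  have cont: "isCont (partial_deriv j g) a" for j
    using assms Ck_imp_continuous_on[of k "partial_deriv j g"]
    by (simp add: continuous_on_eq_continuous_at)
  then have "\<forall>j. \<exists>d>0. \<forall>b. dist b a < d \<longrightarrow> dist (partial_deriv j g b) (partial_deriv j g a) < c"
    using \<open>c > 0\<close> by (auto simp: continuous_at_eps_delta dist_norm)
  then obtain dd where dd: "\<And>j. dd j > 0"
    "\<And>j b. dist b a < dd j \<Longrightarrow> dist (partial_deriv j g b) (partial_deriv j g a) < c"
    by metis
  define d where "d = Min (range dd)"
  have "d > 0" using dd by (simp add: d_def)
  have d_le: "d \<le> dd j" for j by (simp add: d_def)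
  show "\<exists>d>0. \<forall>y. norm (y - a) < d \<longrightarrow>
     norm (g y - g a - (\<Sum>j\<in>UNIV. vec_nth (y - a) j *\<^sub>R partial_deriv j g a)) \<le> e * norm (y - a)"
  proof (intro exI[of _ d] conjI allI impI \<open>d > 0\<close>)
    fix y assume y: "norm (y - a) < d"
    define v where "v = y - a"
    \<comment> \<open>\<open>p S\<close> keeps the coordinates of \<open>v\<close> in
      \<open>S\<close>; enlarging \<open>S\<close> by one index is a move along one axis.\<close>
    define p where "p S = (\<chi> j. if j \<in> S then vec_nth v j else 0)" for S
    have step: "norm (g (a + p S) - g a - (\<Sum>j\<in>S. vec_nth v j *\<^sub>R partial_deriv j g a))
      \<le> real (card S) * (c * norm v)" if "finite S" for S
      using that
    proof (induction S rule: finite_induct)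
      case empty
      have "p {} = 0" by (simp add: p_def Finite_Cartesian_Product.vec_eq_iff)
      then show ?case by simp
    next
      case (insert i S)
      have ins: "p (insert i S) = p S + vec_nth v i *\<^sub>R axis i 1"
        using insert(2) by (auto simp: p_def Finite_Cartesian_Product.vec_eq_iff axis_def)
      \<comment> \<open>With the linear part removed, the derivative of \<open>G\<close> is a
        difference of partial derivatives, small by continuity at \<open>a\<close>.\<close>
      define G where "G = (\<lambda>s. g ((a + p S) + s *\<^sub>R axis i 1) - s *\<^sub>R partial_deriv i g a)"
      have near: "norm (partial_deriv i g ((a + p S) + s *\<^sub>R axis i 1) - partial_deriv i g a) \<le> c"
        if s: "s \<in> closed_segment 0 (vec_nth v i)" for s
      proof -
        have abs_s: "\<bar>s\<bar> \<le> \<bar>vec_nth v i\<bar>"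
          using s by (auto simp: closed_segment_eq_real_ivl split: if_splits)
        \<comment> \<open>Truncating \<open>v\<close> does not increase its norm, so the whole path
          stays in the ball where the partial derivatives are controlled.\<close>
        have "norm (p S + s *\<^sub>R axis i 1) \<le> norm v"
          by (rule norm_le_componentwise_cart)
             (use abs_s insert(2) in \<open>auto simp: p_def axis_def\<close>)
        then have "dist ((a + p S) + s *\<^sub>R axis i 1) a < dd i"
          using y d_le[of i] by (simp add: dist_norm v_def add.assoc)
        then show ?thesis using dd(2)[of "(a + p S) + s *\<^sub>R axis i 1" i] by (simp add: dist_norm)
      qed
      have "norm (G (vec_nth v i) - G 0) \<le> c * norm (vec_nth v i - 0)"
      proof (rule differentiable_bound[OF convex_closed_segment])
        fix s assume "s \<in> closed_segment 0 (vec_nth v i)"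
        show "(G has_derivative (\<lambda>r. r *\<^sub>R (partial_deriv i g ((a + p S) + s *\<^sub>R axis i 1) - partial_deriv i g a)))
          (at s within closed_segment 0 (vec_nth v i))"
          unfolding G_def has_vector_derivative_def[symmetric]
          by (intro has_vector_derivative_diff has_vector_derivative_at_within[OF Ck_Suc_has_partial[OF assms]])
             (auto intro!: derivative_eq_intros)
      next
        fix s assume "s \<in> closed_segment 0 (vec_nth v i)"
        then show "onorm (\<lambda>r. r *\<^sub>R (partial_deriv i g ((a + p S) + s *\<^sub>R axis i 1) - partial_deriv i g a)) \<le> c"
          using near by (intro onorm_le) (simp add: mult.commute[of c] mult_left_mono)
      qed auto
      also have "\<dots> \<le> c * norm v"
        using \<open>c > 0\<close> component_le_norm_cart[of v i] by simp
      finally have G: "norm (G (vec_nth v i) - G 0) \<le> c * norm v" .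
      have eq: "g (a + p (insert i S)) - g a - (\<Sum>j\<in>insert i S. vec_nth v j *\<^sub>R partial_deriv j g a)
        = (g (a + p S) - g a - (\<Sum>j\<in>S. vec_nth v j *\<^sub>R partial_deriv j g a)) + (G (vec_nth v i) - G 0)"
        using insert(1,2) by (simp add: G_def ins add.assoc)
      have "norm (g (a + p (insert i S)) - g a - (\<Sum>j\<in>insert i S. vec_nth v j *\<^sub>R partial_deriv j g a))
        \<le> real (card S) * (c * norm v) + c * norm v"
        unfolding eq by (rule norm_triangle_mono[OF insert(3) G])
      then show ?case using insert(1,2) by (simp add: distrib_right)
    qed
    have pv: "p UNIV = v" by (simp add: p_def Finite_Cartesian_Product.vec_eq_iff)
    have ce: "real CARD('d) * (c * norm v) = e * norm v" by (simp add: c_def)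
    show "norm (g y - g a - (\<Sum>j\<in>UNIV. vec_nth (y - a) j *\<^sub>R partial_deriv j g a)) \<le> e * norm (y - a)"
      using step[of UNIV, OF finite] unfolding pv ce unfolding v_def by simp
  qed
qed

text \<open>The derivative of g(x(t)) is a sum of products of components of x' with partial
  derivatives of g along x. The induction hypothesis applies to the latter, hence the generalisation
  over \<open>g\<close>.\<close>

lemma diff_on_Ck_compose:
  fixes x :: "real \<Rightarrow> real^'d::finite"
  shows "Ck k g \<Longrightarrow> diff_on T k x \<Longrightarrow> diff_on T k (\<lambda>t. g (x t))"
proof (induction k arbitrary: g x)
  case 0
  then show ?case by (auto intro: continuous_on_compose2)
next
  case (Suc k)
  then obtain x' where
    x': "\<forall>t\<in>{0..T}. (x has_vector_derivative x' t) (at t within {0..T})" "diff_on T k x'" by auto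
  have deriv: "((\<lambda>t. g (x t)) has_vector_derivative (\<Sum>j\<in>UNIV. vec_nth (x' t) j *\<^sub>R partial_deriv j g (x t)))
      (at t within {0..T})" if "t \<in> {0..T}" for t
    using vector_derivative_diff_chain_within[of x "x' t" t "{0..T}" g]
      has_derivative_at_withinI[OF Ck_Suc_has_derivative[OF Suc.prems(1)]] x' that
    unfolding o_def by blast
  have "diff_on T k (\<lambda>t. partial_deriv j g (x t))" for j
    using Suc.IH[of "partial_deriv j g" x] Suc.prems by (auto dest: diff_on_Suc_lower simp del: diff_on.simps)
  then have "diff_on T k (\<lambda>t. \<Sum>j\<in>UNIV. vec_nth (x' t) j *\<^sub>R partial_deriv j g (x t))"
    by (intro diff_on_sum diff_on_scaleR diff_on_bounded_linear[OF bounded_linear_vec_nth] x') auto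
  then show ?case by (rule diff_on_SucI[rotated]) (rule deriv)
qed

lemma Ck_Suc_lower: "Ck (Suc k) g \<Longrightarrow> Ck k g"
  by (induction k arbitrary: g) auto

text \<open>Bootstrapping: once x has class k+1, so has x' = f(x) when f does, and x gains one more
  derivative.\<close>

lemma ode_solution_diff_on:
  fixes x :: "real \<Rightarrow> real^'d::finite"
  assumes ode: "\<And>t. t \<in> {0..T} \<Longrightarrow> (x has_vector_derivative f (x t)) (at t within {0..T})"
  shows "Ck k f \<Longrightarrow> diff_on T (Suc k) x"
proof (induction k)
  case 0
  have "continuous_on {0..T} x"
    using ode by (rule continuous_on_vector_derivative)
  with 0 have "continuous_on {0..T} (\<lambda>t. f (x t))" by (auto intro: continuous_on_compose2)
  then have "diff_on T 0 (\<lambda>t. f (x t))" by simp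
  then show ?case by (rule diff_on_SucI[rotated]) (rule ode)
next
  case (Suc k)
  have "diff_on T (Suc k) x" by (rule Suc.IH[OF Ck_Suc_lower[OF Suc.prems]])
  then have "diff_on T (Suc k) (\<lambda>t. f (x t))" by (rule diff_on_Ck_compose[OF Suc.prems])
  then show ?case by (rule diff_on_SucI[rotated]) (rule ode)
qed

section \<open>Iterated time derivatives and Taylor expansion\<close>

lemma time_deriv_0 [simp]: "time_deriv T 0 x = x"
  by (simp add: time_deriv_def)

lemma time_deriv_Suc:
  "time_deriv T (Suc i) x t = vector_derivative (time_deriv T i x) (at t within {0..T})"
  by (simp add: time_deriv_def)

text \<open>Since \<open>T > 0\<close>, derivatives within [0,T] are unique, so
  \<open>vector_derivative\<close> agrees there with the witness from
  \<open>diff_on\<close>.\<close>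

lemma vector_derivative_diff_on:
  assumes "T > 0" "diff_on T (Suc k) y"
  shows "diff_on T k (\<lambda>t. vector_derivative y (at t within {0..T}))"
    and "t \<in> {0..T} \<Longrightarrow> (y has_vector_derivative vector_derivative y (at t within {0..T})) (at t within {0..T})"
proof -
  obtain y' where
    y': "\<forall>t\<in>{0..T}. (y has_vector_derivative y' t) (at t within {0..T})" "diff_on T k y'"
    using assms by auto
  have "vector_derivative y (at t within {0..T}) = y' t" if "t \<in> {0..T}" for t
    using vector_derivative_within_cbox[of 0 T t y "y' t"] y' that \<open>T > 0\<close> by auto
  then show "diff_on T k (\<lambda>t. vector_derivative y (at t within {0..T}))"
    and "t \<in> {0..T} \<Longrightarrow> (y has_vector_derivative vector_derivative y (at t within {0..T})) (at t within {0..T})"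
    using y' by (auto intro: diff_on_cong)
qed

lemma time_deriv_diff_on:
  assumes "T > 0"
  shows "diff_on T (i + k) x \<Longrightarrow> diff_on T k (time_deriv T i x)"
proof (induction i arbitrary: k)
  case (Suc i)
  then have "diff_on T (Suc k) (time_deriv T i x)" by (metis add_Suc_shift)
  then show ?case
    using vector_derivative_diff_on(1)[OF assms] by (simp add: time_deriv_Suc[abs_def] del: diff_on.simps)
qed simp

lemma time_deriv_has_vector_derivative:
  assumes "T > 0" "diff_on T m x" "i < m" "t \<in> {0..T}"
  shows "(time_deriv T i x has_vector_derivative time_deriv T (Suc i) x t) (at t within {0..T})"
proof -
  have "diff_on T (Suc (m - Suc i)) (time_deriv T i x)"
    using assms by (intro time_deriv_diff_on) auto
  then show ?thesis
    using vector_derivative_diff_on(2) assms by (metis time_deriv_Suc)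
qed

text \<open>Integral form of the remainder for the i-th derivative with p = q+1-i terms. The kernel
  is at most h^(p-1), its factorial being dropped, and the interval length supplies the last power
  of h.\<close>

lemma time_deriv_Taylor_bound:
  fixes x :: "real \<Rightarrow> 'a::banach"
  assumes "T > 0" "diff_on T (Suc q) x" "i \<le> q" "0 \<le> h" "h \<le> T"
    and B: "\<And>t. t \<in> {0..T} \<Longrightarrow> norm (time_deriv T (Suc q) x t) \<le> B"
  shows "norm (time_deriv T i x h - (\<Sum>k\<le>q-i. (h^k / fact k) *\<^sub>R time_deriv T (i + k) x 0))
    \<le> B * h ^ (q + 1 - i)"
proof -
  define p where "p = q + 1 - i"
  have p: "p > 0" "i + p = Suc q" using assms by (auto simp: p_def)
  have B0: "B \<ge> 0" using order_trans[OF norm_ge_zero B[of 0]] \<open>T > 0\<close> by simp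
  have *: "((\<lambda>x'. ((h - x') ^ (p - 1) / fact (p - 1)) *\<^sub>R time_deriv T (i + p) x x') has_integral
      time_deriv T i x h - (\<Sum>k<p. ((h - 0)^k / fact k) *\<^sub>R time_deriv T (i + k) x 0)) {0..h}"
  proof (rule Taylor_has_integral)
    fix m t assume "m < p" "0 \<le> t" "t \<le> h"
    then show "(time_deriv T (i + m) x has_vector_derivative time_deriv T (i + Suc m) x t) (at t within {0..h})"
      using time_deriv_has_vector_derivative[OF assms(1,2), of "i + m" t] p(2) \<open>h \<le> T\<close>
      by (auto intro: has_vector_derivative_within_subset)
  qed (use p assms in auto)
  have "norm (time_deriv T i x h - (\<Sum>k<p. ((h - 0)^k / fact k) *\<^sub>R time_deriv T (i + k) x 0))
      \<le> B * h ^ (p - 1) * measure lborel (cbox 0 h)"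
  proof (rule has_integral_bound[OF _ *[folded cbox_interval]])
    fix t assume t: "t \<in> cbox 0 h"
    have "\<bar>h - t\<bar> ^ (p - 1) / fact (p - 1) \<le> h ^ (p - 1) / 1"
      using t by (intro frac_le power_mono fact_ge_1) auto
    moreover have "norm (time_deriv T (i + p) x t) \<le> B"
      using B[of t] t \<open>h \<le> T\<close> p by auto
    ultimately have "(\<bar>h - t\<bar> ^ (p - 1) / fact (p - 1)) * norm (time_deriv T (i + p) x t) \<le> h ^ (p - 1) * B"
      using \<open>0 \<le> h\<close> by (intro mult_mono) auto
    then show "norm (((h - t) ^ (p - 1) / fact (p - 1)) *\<^sub>R time_deriv T (i + p) x t) \<le> B * h ^ (p - 1)"
      by (simp add: power_abs mult.commute)
  qed (use B0 assms in auto)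
  moreover have "h ^ (p - 1) * h = h ^ p" using p by (cases p) auto
  moreover have "{..<p} = {..q-i}" using p assms by auto
  ultimately show ?thesis using assms by (simp add: p_def mult.assoc)
qed

subsection \<open>The transition and noise matrices\<close>

lemma mult_mat_index:
  assumes "A \<in> carrier_mat m n" "B \<in> carrier_mat n p" "i < m" "j < p"
  shows "(A * B) $$ (i,j) = (\<Sum>k = 0..<n. A $$ (i,k) * B $$ (k,j))"
  using assms by (auto simp: scalar_prod_def intro!: sum.cong)

text \<open>The hypothesis is the smallness condition tailored to the lower bound on the noise; the
  upper bounds use this weaker consequence.\<close>

lemma small_step_le_1:
  fixes y :: real
  assumes "0 \<le> y" "6 * fact n * y \<le> 1"
  shows "y \<le> 1"
proof -
  have "1 \<le> 6 * (fact n :: real)" using fact_ge_1[of n, where 'a = real] by linarith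
  then have "1 * y \<le> 6 * fact n * y" using assms(1) by (rule mult_right_mono)
  then show ?thesis using assms(2) by simp
qed

text \<open>Powers of F count weighted walks: each step goes from i to i+1 with weight 1, or stays
  at q with weight -theta. A column j < q is reached in exactly j-i steps; column q is reached after
  q-i steps, and all further steps loop there.\<close>

lemma smult_drift_mat_power:
  assumes "i \<le> q" "j \<le> q"
  shows "((s \<cdot>\<^sub>m drift_mat q \<theta>) ^\<^sub>m n) $$ (i,j) =
    s ^ n * (if j < q then (if j = i + n then 1 else 0)
             else if q \<le> i + n then (- \<theta>) ^ (i + n - q) else 0)"
  using \<open>j \<le> q\<close>
proof (induction n arbitrary: j)
  case 0
  then show ?case using assms(1) by (auto simp: drift_mat_def)
next
  case (Suc n)
  let ?M = "s \<cdot>\<^sub>m drift_mat q \<theta>"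
  define c where "c k = (if k < q then (if k = i + n then 1 else 0)
             else if q \<le> i + n then (- \<theta>) ^ (i + n - q) else 0)" for k
  have M: "?M \<in> carrier_mat (q+1) (q+1)" by (simp add: drift_mat_def)
  have "(?M ^\<^sub>m Suc n) $$ (i,j) = (\<Sum>k = 0..<q+1. (?M ^\<^sub>m n) $$ (i,k) * ?M $$ (k,j))"
    unfolding pow_mat.simps using pow_carrier_mat[OF M] M assms(1) Suc.prems by (intro mult_mat_index[of _ "q+1" _ _ "q+1"]) auto
  also have "\<dots> = (\<Sum>k = 0..<q+1. (s ^ n * c k) * (s * (if j = k + 1 then 1 else if k = q \<and> j = q then - \<theta> else 0)))"
    using Suc.IH Suc.prems unfolding c_def by (intro sum.cong) (auto simp: drift_mat_def)
  also have "\<dots> = s ^ Suc n * (\<Sum>k\<le>q. c k * (if j = k + 1 then 1 else if k = q \<and> j = q then - \<theta> else 0))"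
    by (simp add: sum_distrib_left ac_simps atLeast0LessThan lessThan_Suc_atMost)
  \<comment> \<open>The last step of a walk either comes from column j-1 or is the loop at
    q.\<close>
  also have "(\<Sum>k\<le>q. c k * (if j = k + 1 then 1 else if k = q \<and> j = q then - \<theta> else 0))
    = (\<Sum>k\<le>q. (if j = k + 1 then c k else 0)) + (\<Sum>k\<le>q. (if k = q then (if j = q then - \<theta> * c q else 0) else 0))"
    unfolding sum.distrib[symmetric] by (intro sum.cong) auto
  also have "(\<Sum>k\<le>q. (if j = k + 1 then c k else 0)) = (if 1 \<le> j then c (j - 1) else 0)"
  proof (cases "1 \<le> j")
    case True
    then have "(\<Sum>k\<le>q. (if j = k + 1 then c k else 0)) = (\<Sum>k\<le>q. (if k = j - 1 then c k else 0))"
      by (intro sum.cong) auto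
    then show ?thesis using True Suc.prems by simp
  qed simp
  also have "(\<Sum>k\<le>q. (if k = q then (if j = q then - \<theta> * c q else 0) else 0)) = (if j = q then - \<theta> * c q else 0)"
    by simp
  also have "(if 1 \<le> j then c (j - 1) else 0) + (if j = q then - \<theta> * c q else 0) =
      (if j < q then (if j = i + Suc n then 1 else 0)
             else if q \<le> i + Suc n then (- \<theta>) ^ (i + Suc n - q) else 0)"
  proof -
    \<comment> \<open>For column q: it can already be reached in n steps, or exactly at step n+1, or
      not yet.\<close>
    consider "j < q" | "j = q" "q \<le> i + n" | "j = q" "q = i + Suc n" | "j = q" "q > i + Suc n"
      using Suc.prems by linarith
    then show ?thesis
    proof cases
      case 2
      then show ?thesis using assms(1) by (auto simp: c_def Suc_diff_le)
    qed (use assms(1) in \<open>auto simp: c_def\<close>)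
  qed
  finally show ?case .
qed

lemma trans_mat_carrier: "trans_mat q \<theta> s \<in> carrier_mat (q+1) (q+1)"
  by (simp add: trans_mat_def mat_exp_def drift_mat_def)

lemma trans_mat_index:
  assumes "i \<le> q" "j \<le> q"
  shows "trans_mat q \<theta> s $$ (i,j) =
    (\<Sum>n. (if j < q then (if j = i + n then 1 else 0)
          else if q \<le> i + n then (- \<theta>) ^ (i + n - q) else 0) / fact n * s ^ n)"
  using assms smult_drift_mat_power[OF assms, of s \<theta>]
  unfolding trans_mat_def mat_exp_def
  by (simp add: drift_mat_def[of q \<theta>, THEN arg_cong[where f = dim_row]] ac_simps)

text \<open>Only the power n = j-i contributes, so the exponential series has at most one nonzero
  term and theta does not enter.\<close>

lemma trans_mat_lower:
  assumes "i \<le> q" "j < q"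
  shows "trans_mat q \<theta> s $$ (i,j) = (if i \<le> j then s ^ (j - i) / fact (j - i) else 0)"
proof (cases "i \<le> j")
  case True
  have "(\<lambda>n. (if j = i + n then 1 else 0) / fact n * s ^ n) =
      (\<lambda>n. if n = j - i then s ^ n / fact n else 0)"
    using True by auto
  then show ?thesis using True assms sums_unique[OF sums_single[of "j - i" "\<lambda>n. s ^ n / fact n"]]
    by (simp add: trans_mat_index)
next
  case False
  then have "(\<lambda>n. (if j = i + n then 1 else 0) / fact n * s ^ n) = (\<lambda>n. 0)" by auto
  then show ?thesis using False assms by (simp add: trans_mat_index)
qed

text \<open>Coefficient of s^n in the entry (i,q) of exp(sF). Isolating it makes that entry an
  ordinary power series in s.\<close>

definition last_coeff :: "nat \<Rightarrow> real \<Rightarrow> nat \<Rightarrow> nat \<Rightarrow> real" where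
  "last_coeff q \<theta> i n = (if q \<le> i + n then (- \<theta>) ^ (i + n - q) else 0) / fact n"

lemma trans_mat_last:
  "i \<le> q \<Longrightarrow> trans_mat q \<theta> s $$ (i,q) = (\<Sum>n. last_coeff q \<theta> i n * s ^ n)"
  by (simp add: trans_mat_index last_coeff_def)

lemma summable_last_coeff:
  assumes "i \<le> q"
  shows "summable (\<lambda>n. last_coeff q \<theta> i n * s ^ n)"
proof (rule summable_comparison_test)
  \<comment> \<open>With a base of at least 1 the exponent i+n-q may be raised to n, which leaves an
    exponential series as majorant.\<close>
  define b where "b = (1 + \<bar>\<theta>\<bar>) * \<bar>s\<bar>"
  show "summable (\<lambda>n. inverse (fact n) * b ^ n)" by (rule summable_exp)
  have "norm (last_coeff q \<theta> i n * s ^ n) \<le> inverse (fact n) * b ^ n" for n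
  proof -
    have "\<bar>if q \<le> i + n then (- \<theta>) ^ (i + n - q) else 0\<bar> \<le> (1 + \<bar>\<theta>\<bar>) ^ n"
    proof (cases "q \<le> i + n")
      case True
      have "\<bar>\<theta>\<bar> ^ (i + n - q) \<le> (1 + \<bar>\<theta>\<bar>) ^ (i + n - q)" by (intro power_mono) auto
      also have "\<dots> \<le> (1 + \<bar>\<theta>\<bar>) ^ n" using assms by (intro power_increasing) auto
      finally show ?thesis using True by (simp add: power_abs)
    qed simp
    then have "\<bar>if q \<le> i + n then (- \<theta>) ^ (i + n - q) else 0\<bar> / fact n * \<bar>s\<bar> ^ n
        \<le> (1 + \<bar>\<theta>\<bar>) ^ n / fact n * \<bar>s\<bar> ^ n"
      by (intro mult_right_mono divide_right_mono) auto
    then show ?thesis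
      by (simp add: last_coeff_def b_def power_mult_distrib abs_mult power_abs divide_inverse mult_ac)
  qed
  then show "\<exists>N. \<forall>n\<ge>N. norm (last_coeff q \<theta> i n * s ^ n) \<le> inverse (fact n) * b ^ n" by blast
qed

text \<open>Supplies the integrability of the noise integrand.\<close>

lemma continuous_on_trans_mat_last:
  assumes "i \<le> q"
  shows "continuous_on A (\<lambda>s. trans_mat q \<theta> s $$ (i,q))"
  unfolding trans_mat_last[OF assms]
  by (intro continuous_at_imp_continuous_on ballI isCont_powser_converges_everywhere
      summable_last_coeff assms)

text \<open>The terms below n = q-i vanish and the one at q-i is the Taylor coefficient. The tail is
  theta * s^(q+1-i) times terms dominated by 1/n!, because theta * s is at most 1; the factor 3
  bounds e.\<close>

lemma trans_mat_last_approx: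
  assumes "i \<le> q" "0 \<le> \<theta>" "0 \<le> s" "\<theta> * s \<le> 1"
  shows "\<bar>trans_mat q \<theta> s $$ (i,q) - s ^ (q - i) / fact (q - i)\<bar> \<le> 3 * (\<theta> * s ^ (q + 1 - i))"
proof -
  define a where "a n = last_coeff q \<theta> i n * s ^ n" for n
  define k where "k = q + 1 - i"
  have sa: "summable a" unfolding a_def by (rule summable_last_coeff[OF assms(1)])
  have k: "k = Suc (q - i)" using assms by (simp add: k_def)
  have head: "(\<Sum>n<k. a n) = s ^ (q - i) / fact (q - i)"
  proof -
    have "(\<Sum>n<q - i. a n) = 0" by (intro sum.neutral) (auto simp: a_def last_coeff_def)
    moreover have "a (q - i) = s ^ (q - i) / fact (q - i)" using assms by (simp add: a_def last_coeff_def)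
    ultimately show ?thesis by (simp add: k)
  qed
  have tail: "norm (a (n + k)) \<le> \<theta> * s ^ k * (1 ^ n /\<^sub>R fact n)" for n
  proof -
    have "\<bar>a (n + k)\<bar> = \<theta> ^ (n + 1) / fact (n + k) * s ^ (n + k)"
      using assms by (simp add: a_def last_coeff_def k abs_mult power_abs)
    also have "\<dots> = (\<theta> * s ^ k) * ((\<theta> * s) ^ n / fact (n + k))"
      by (simp add: power_add power_mult_distrib)
    also have "\<dots> \<le> (\<theta> * s ^ k) * (1 / fact n)"
      using assms by (intro mult_left_mono frac_le power_le_one fact_mono) auto
    finally show ?thesis by (simp add: divide_inverse)
  qed
  have "trans_mat q \<theta> s $$ (i,q) - s ^ (q - i) / fact (q - i) = (\<Sum>n. a (n + k))"
    using suminf_split_initial_segment[OF sa, of k] head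
    by (simp add: trans_mat_last[OF assms(1)] a_def[abs_def])
  also have "norm \<dots> \<le> (\<Sum>n. \<theta> * s ^ k * (1 ^ n /\<^sub>R fact n))"
    by (intro norm_suminf_le summable_mult summable_exp_generic tail)
  also have "\<dots> = \<theta> * s ^ k * exp 1"
    unfolding exp_def by (intro suminf_mult summable_exp_generic)
  also have "\<dots> \<le> \<theta> * s ^ k * 3"
    using exp_le assms by (intro mult_left_mono) auto
  finally show ?thesis by (simp add: k_def mult_ac)
qed

text \<open>The constant is 4 = 1 + 3: the Taylor coefficient plus the drift error, whose extra
  factor theta * s is at most 1.\<close>

lemma trans_mat_bound:
  assumes "i \<le> q" "j \<le> q" "0 \<le> \<theta>" "0 \<le> s" "\<theta> * s \<le> 1"
  shows "\<bar>trans_mat q \<theta> s $$ (i,j)\<bar> \<le> (if i \<le> j then 4 * s ^ (j - i) else 0)"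
proof (cases "j < q")
  case True
  have "s ^ (j - i) / fact (j - i) \<le> s ^ (j - i) / 1"
    using assms by (intro divide_left_mono fact_ge_1) auto
  moreover have "0 \<le> s ^ (j - i)" using assms by simp
  ultimately have "s ^ (j - i) / fact (j - i) \<le> 4 * s ^ (j - i)" by simp
  then show ?thesis using True assms by (simp add: trans_mat_lower)
next
  case False
  then have j: "j = q" using assms by simp
  have "s ^ (q - i) / fact (q - i) \<le> s ^ (q - i) / 1"
    using assms by (intro divide_left_mono fact_ge_1) auto
  moreover have "\<theta> * s ^ (q + 1 - i) \<le> s ^ (q - i)"
    using mult_right_mono[OF assms(5), of "s ^ (q - i)"] assms by (simp add: Suc_diff_le mult_ac)
  moreover have "0 \<le> s ^ (q - i) / fact (q - i)" using assms by simp
  moreover note trans_mat_last_approx[OF assms(1,3,4,5)]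
  ultimately have "\<bar>trans_mat q \<theta> s $$ (i,q)\<bar> \<le> 4 * s ^ (q - i)" by linarith
  then show ?thesis using j assms by simp
qed

text \<open>Origin of the 6: the drift error 3 * theta * s^q must consume at most half of the
  leading term s^(q-1)/(q-1)!.\<close>

lemma trans_mat_lower_bound_1:
  assumes "q \<ge> 1" "0 \<le> \<theta>" "0 \<le> s" "6 * fact (q - 1) * (\<theta> * s) \<le> 1"
  shows "s ^ (q - 1) / (2 * fact (q - 1)) \<le> trans_mat q \<theta> s $$ (1,q)"
proof -
  have le1: "\<theta> * s \<le> 1" using assms by (simp add: small_step_le_1[of _ "q - 1"])
  have "(6 * fact (q - 1) * (\<theta> * s)) * s ^ (q - 1) \<le> 1 * s ^ (q - 1)"
    using assms by (intro mult_right_mono) auto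
  moreover have "s * s ^ (q - 1) = s ^ q" using assms by (cases q) auto
  ultimately have "6 * fact (q - 1) * (\<theta> * s ^ q) \<le> s ^ (q - 1)"
    by (simp add: mult.assoc)
  then have "3 * (\<theta> * s ^ q) \<le> s ^ (q - 1) / (2 * fact (q - 1))"
    by (simp add: field_simps)
  moreover have "\<bar>trans_mat q \<theta> s $$ (1,q) - s ^ (q - 1) / fact (q - 1)\<bar> \<le> 3 * (\<theta> * s ^ q)"
    using trans_mat_last_approx[of 1 q \<theta> s] assms le1 by simp
  moreover have "s ^ (q - 1) / fact (q - 1) = 2 * (s ^ (q - 1) / (2 * fact (q - 1)))" by simp
  ultimately show ?thesis by linarith
qed

section \<open>Two-sided bounds on the process noise\<close>

text \<open>The outer product of the scale column with itself has (q,q) as its only possibly nonzero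
  entry, so only the last column of the transition matrix enters.\<close>

lemma noise_mat_index:
  assumes "k \<le> q" "l \<le> q"
  shows "noise_mat q \<theta> s h $$ (k,l) =
    integral {0..h} (\<lambda>\<tau>. s\<^sup>2 * (trans_mat q \<theta> (h - \<tau>) $$ (k,q) * trans_mat q \<theta> (h - \<tau>) $$ (l,q)))"
proof -
  have "(A * (scale_col q s * transpose_mat (scale_col q s)) * transpose_mat A) $$ (k,l)
      = s\<^sup>2 * (A $$ (k,q) * A $$ (l,q))" if A: "A \<in> carrier_mat (q+1) (q+1)" for A
  proof -
    have c: "(scale_col q s * transpose_mat (scale_col q s)) $$ (i,j) = (if i = q \<and> j = q then s\<^sup>2 else 0)"
      if "i \<le> q" "j \<le> q" for i j
      using that by (simp add: scale_col_def scalar_prod_def power2_eq_square)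
    have d: "scale_col q s * transpose_mat (scale_col q s) \<in> carrier_mat (q+1) (q+1)"
      by (simp add: scale_col_def carrier_matI)
    have e: "(A * (scale_col q s * transpose_mat (scale_col q s))) $$ (k,j) = (if j = q then A $$ (k,q) * s\<^sup>2 else 0)"
      if "j \<le> q" for j
    proof -
      have "(A * (scale_col q s * transpose_mat (scale_col q s))) $$ (k,j) =
        (\<Sum>i = 0..<q+1. A $$ (k,i) * (scale_col q s * transpose_mat (scale_col q s)) $$ (i,j))"
        using A d assms that by (intro mult_mat_index) auto
      also have "\<dots> = (\<Sum>i = 0..<q+1. if i = q then (if j = q then A $$ (k,q) * s\<^sup>2 else 0) else 0)"
        using that c by (intro sum.cong) auto
      finally show ?thesis by simp
    qed
    have "(A * (scale_col q s * transpose_mat (scale_col q s)) * transpose_mat A) $$ (k,l) =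
        (\<Sum>j = 0..<q+1. (A * (scale_col q s * transpose_mat (scale_col q s))) $$ (k,j) * transpose_mat A $$ (j,l))"
      using A d assms by (intro mult_mat_index[of _ "q+1" _ _ "q+1"]) auto
    also have "\<dots> = (\<Sum>j = 0..<q+1. if j = q then A $$ (k,q) * s\<^sup>2 * A $$ (l,q) else 0)"
      using e A assms by (intro sum.cong) auto
    finally show ?thesis by simp
  qed
  from this[OF trans_mat_carrier[of q \<theta>, unfolded trans_mat_def]] show ?thesis
    using assms by (simp add: noise_mat_def trans_mat_def)
qed

lemma continuous_on_noise_integrand:
  assumes "k \<le> q" "l \<le> q"
  shows "continuous_on A (\<lambda>\<tau>. s\<^sup>2 * (trans_mat q \<theta> (h - \<tau>) $$ (k,q) * trans_mat q \<theta> (h - \<tau>) $$ (l,q)))"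
  by (intro continuous_intros continuous_on_compose2[OF continuous_on_trans_mat_last[of _ q UNIV \<theta>]] assms) auto

text \<open>16 = 4 * 4 from the two transition entries; the length of the interval raises the
  exponent by one.\<close>

lemma noise_mat_bound:
  assumes "k \<le> q" "l \<le> q" "0 \<le> \<theta>" "0 \<le> h" "\<theta> * h \<le> 1"
  shows "\<bar>noise_mat q \<theta> s h $$ (k,l)\<bar> \<le> 16 * s\<^sup>2 * h ^ (2*q+1-k-l)"
proof -
  have "norm (noise_mat q \<theta> s h $$ (k,l)) \<le> (16 * s\<^sup>2 * h ^ (2*q-k-l)) * (h - 0)"
    unfolding noise_mat_index[OF assms(1,2)]
  proof (rule integral_bound)
    fix \<tau> assume t: "\<tau> \<in> {0..h}"
    have b: "\<bar>trans_mat q \<theta> (h - \<tau>) $$ (i,q)\<bar> \<le> 4 * h ^ (q - i)" if "i \<le> q" for i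
    proof -
      have "\<theta> * (h - \<tau>) \<le> \<theta> * h" using t assms by (intro mult_left_mono) auto
      then have "\<bar>trans_mat q \<theta> (h - \<tau>) $$ (i,q)\<bar> \<le> 4 * (h - \<tau>) ^ (q - i)"
        using trans_mat_bound[of i q q \<theta> "h - \<tau>"] that t assms by simp
      also have "\<dots> \<le> 4 * h ^ (q - i)" using t by (intro mult_left_mono power_mono) auto
      finally show ?thesis .
    qed
    have "\<bar>trans_mat q \<theta> (h - \<tau>) $$ (k,q)\<bar> * \<bar>trans_mat q \<theta> (h - \<tau>) $$ (l,q)\<bar>
        \<le> (4 * h ^ (q - k)) * (4 * h ^ (q - l))"
      using b assms by (intro mult_mono) auto
    also have "\<dots> = 16 * h ^ (2*q-k-l)"
    proof -
      have "2*q-k-l = (q - k) + (q - l)" using assms by simp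
      then show ?thesis by (simp only: power_add)
    qed
    finally have "s\<^sup>2 * (\<bar>trans_mat q \<theta> (h - \<tau>) $$ (k,q)\<bar> * \<bar>trans_mat q \<theta> (h - \<tau>) $$ (l,q)\<bar>)
        \<le> s\<^sup>2 * (16 * h ^ (2*q-k-l))" by (intro mult_left_mono) auto
    then show "norm (s\<^sup>2 * (trans_mat q \<theta> (h - \<tau>) $$ (k,q) * trans_mat q \<theta> (h - \<tau>) $$ (l,q)))
        \<le> 16 * s\<^sup>2 * h ^ (2*q-k-l)"
      by (simp add: abs_mult mult_ac)
  qed (use assms continuous_on_noise_integrand in auto)
  moreover have "2*q+1-k-l = Suc (2*q-k-l)" using assms by simp
  ultimately show ?thesis by (simp add: mult_ac)
qed

text \<open>The integrand is \<open>s\<^sup>2\<close> times a square, so the integral may be cut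
  down to the half where h - tau is at least h/2. There the integrand has a positive lower bound of
  order 2(q-1), and the length h/2 gives the remaining power.\<close>

lemma noise_mat_lower_bound:
  assumes "q \<ge> 1" "0 \<le> \<theta>" "0 < h" "6 * fact (q - 1) * (\<theta> * h) \<le> 1"
  shows "s\<^sup>2 * ((h / 2) ^ (2*q-1) / (2 * fact (q - 1))\<^sup>2) \<le> noise_mat q \<theta> s h $$ (1,1)"
proof -
  define g where "g = (\<lambda>\<tau>. s\<^sup>2 * (trans_mat q \<theta> (h - \<tau>) $$ (1,q) * trans_mat q \<theta> (h - \<tau>) $$ (1,q)))"
  have int: "g integrable_on {a..b}" for a b
    unfolding g_def using assms by (intro integrable_continuous_real continuous_on_noise_integrand) auto
  define B where "B = s\<^sup>2 * ((h / 2) ^ (2*(q-1)) / (2 * fact (q - 1))\<^sup>2)"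
  have "B \<le> g \<tau>" if t: "\<tau> \<in> {0..h/2}" for \<tau>
  proof -
    have t': "h / 2 \<le> h - \<tau>" "0 \<le> h - \<tau>" using t assms by auto
    have "6 * fact (q - 1) * (\<theta> * (h - \<tau>)) \<le> 6 * fact (q - 1) * (\<theta> * h)"
      using t assms by (intro mult_left_mono) auto
    then have "6 * fact (q - 1) * (\<theta> * (h - \<tau>)) \<le> 1" using assms(4) by (rule order_trans)
    then have "(h - \<tau>) ^ (q - 1) / (2 * fact (q - 1)) \<le> trans_mat q \<theta> (h - \<tau>) $$ (1,q)"
      using assms t' by (intro trans_mat_lower_bound_1) auto
    moreover have "(h / 2) ^ (q - 1) / (2 * fact (q - 1)) \<le> (h - \<tau>) ^ (q - 1) / (2 * fact (q - 1))"
      using t' assms by (intro divide_right_mono power_mono) auto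
    ultimately have "(h / 2) ^ (q - 1) / (2 * fact (q - 1)) \<le> trans_mat q \<theta> (h - \<tau>) $$ (1,q)" by simp
    then have "((h / 2) ^ (q - 1) / (2 * fact (q - 1)))\<^sup>2 \<le> (trans_mat q \<theta> (h - \<tau>) $$ (1,q))\<^sup>2"
      using assms by (intro power_mono) auto
    then show ?thesis
      unfolding B_def g_def power2_eq_square[symmetric, of "trans_mat q \<theta> (h - \<tau>) $$ (1,q)"]
      by (intro mult_left_mono) (auto simp: power_divide power_mult_distrib power_mult mult.commute[of 2])
  qed
  then have "integral {0..h/2} (\<lambda>\<tau>. B) \<le> integral {0..h/2} g"
    by (intro integral_le int) auto
  also have "\<dots> \<le> integral {0..h} g"
    by (intro integral_subset_le int) (auto simp: g_def assms less_imp_le)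
  also have "\<dots> = noise_mat q \<theta> s h $$ (1,1)"
    using assms by (simp add: noise_mat_index g_def)
  finally have "h / 2 * B \<le> noise_mat q \<theta> s h $$ (1,1)" using assms by simp
  moreover have "h / 2 * B = s\<^sup>2 * ((h / 2) ^ (2*q-1) / (2 * fact (q - 1))\<^sup>2)"
  proof -
    have "2*q-1 = Suc (2*(q-1))" using assms by simp
    then have "(h / 2) ^ (2*q-1) = h / 2 * (h / 2) ^ (2*(q-1))" by (simp only: power_Suc)
    then show ?thesis by (simp only: B_def times_divide_eq_right mult.left_commute)
  qed
  ultimately show ?thesis by simp
qed

section \<open>Predicted covariance and gains\<close>

text \<open>On the diagonal this is the quadratic form of P at a row of A, hence nonnegative for
  positive semidefinite P.\<close>

lemma congruence_index:
  fixes A P :: "real mat"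
  assumes A: "A \<in> carrier_mat n n" and P: "P \<in> carrier_mat n n" and "i < n" "j < n"
  shows "(A * P * transpose_mat A) $$ (i,j) = scalar_prod (row A i) (P *\<^sub>v row A j)"
proof -
  have "(A * P * transpose_mat A) $$ (i,j) = (A * (P * transpose_mat A)) $$ (i,j)"
    using A P by (simp add: assoc_mult_mat[of A n n P n "transpose_mat A" n])
  also have "\<dots> = scalar_prod (row A i) (col (P * transpose_mat A) j)" using assms by simp
  also have "col (P * transpose_mat A) j = P *\<^sub>v row A j"
    using assms by (intro Matrix.eq_vecI) auto
  finally show ?thesis .
qed

text \<open>A is upper triangular, so only k >= i and l >= j contribute; there the exponents k-i,
  2q+1-k-l and l-j add up to 2q+1-i-j. The constant counts (q+1)^2 summands with a factor 4 from
  each copy of A.\<close>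

lemma congruence_bound:
  assumes P: "P \<in> carrier_mat (q+1) (q+1)" and "i \<le> q" "j \<le> q" "0 \<le> \<theta>" "0 \<le> h" "\<theta> * h \<le> 1"
    and "0 \<le> C" and bd: "\<And>k l. k \<le> q \<Longrightarrow> l \<le> q \<Longrightarrow> \<bar>P $$ (k,l)\<bar> \<le> C * h ^ (2*q+1-k-l)"
  shows "\<bar>(trans_mat q \<theta> h * P * transpose_mat (trans_mat q \<theta> h)) $$ (i,j)\<bar>
    \<le> 16 * (real (q+1))\<^sup>2 * C * h ^ (2*q+1-i-j)"
proof -
  define A where "A = trans_mat q \<theta> h"
  have A: "A \<in> carrier_mat (q+1) (q+1)" unfolding A_def by (rule trans_mat_carrier)
  have A_bd: "\<bar>A $$ (m,k)\<bar> \<le> (if m \<le> k then 4 * h ^ (k - m) else 0)" if "m \<le> q" "k \<le> q" for m k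
    unfolding A_def using that assms(4-6) by (intro trans_mat_bound) auto
  have "(A * P * transpose_mat A) $$ (i,j) = (\<Sum>l = 0..<q+1. (A * P) $$ (i,l) * transpose_mat A $$ (l,j))"
    using A P assms(2,3) by (intro mult_mat_index[of _ "q+1" _ _ "q+1"]) auto
  also have "\<dots> = (\<Sum>l = 0..<q+1. (\<Sum>k = 0..<q+1. A $$ (i,k) * P $$ (k,l)) * A $$ (j,l))"
  proof (rule sum.cong[OF refl])
    fix l assume "l \<in> {0..<q+1}"
    then show "(A * P) $$ (i,l) * transpose_mat A $$ (l,j) = (\<Sum>k = 0..<q+1. A $$ (i,k) * P $$ (k,l)) * A $$ (j,l)"
      using mult_mat_index[OF A P, of i l] A assms(2,3) by simp
  qed
  also have "\<dots> = (\<Sum>l = 0..<q+1. \<Sum>k = 0..<q+1. A $$ (i,k) * P $$ (k,l) * A $$ (j,l))"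
    by (simp only: sum_distrib_right)
  also have "\<bar>\<dots>\<bar> \<le> (\<Sum>l = 0..<q+1. \<Sum>k = 0..<q+1. 16 * C * h ^ (2*q+1-i-j))"
  proof (intro order_trans[OF sum_abs] sum_mono)
    fix k l assume "k \<in> {0..<q+1}" "l \<in> {0..<q+1}"
    then have kl: "k \<le> q" "l \<le> q" by auto
    show "\<bar>A $$ (i,k) * P $$ (k,l) * A $$ (j,l)\<bar> \<le> 16 * C * h ^ (2*q+1-i-j)"
    proof (cases "i \<le> k \<and> j \<le> l")
      case True
      then have b1: "\<bar>A $$ (i,k)\<bar> \<le> 4 * h ^ (k - i)" and b2: "\<bar>A $$ (j,l)\<bar> \<le> 4 * h ^ (l - j)"
        using A_bd[OF assms(2) kl(1)] A_bd[OF assms(3) kl(2)] by auto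
      have "\<bar>A $$ (i,k)\<bar> * \<bar>P $$ (k,l)\<bar> * \<bar>A $$ (j,l)\<bar>
        \<le> (4 * h ^ (k - i)) * (C * h ^ (2*q+1-k-l)) * (4 * h ^ (l - j))"
        by (intro mult_mono b1 b2 bd kl) (simp_all add: assms(5,7))
      also have "\<dots> = 16 * C * (h ^ ((k - i) + (2*q+1-k-l) + (l - j)))"
        by (simp only: power_add) simp
      also have "(k - i) + (2*q+1-k-l) + (l - j) = 2*q+1-i-j" using True kl by auto
      finally show ?thesis by (simp only: abs_mult)
    next
      case False
      then have "A $$ (i,k) = 0 \<or> A $$ (j,l) = 0"
        using A_bd[OF assms(2) kl(1)] A_bd[OF assms(3) kl(2)] by (auto split: if_splits)
      moreover have "0 \<le> 16 * C * h ^ (2*q+1-i-j)" using assms(5,7) by simp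
      ultimately show ?thesis by auto
    qed
  qed
  also have "\<dots> = 16 * (real (q+1))\<^sup>2 * C * h ^ (2*q+1-i-j)"
    by (simp add: power2_eq_square)
  finally show ?thesis by (simp only: A_def)
qed

text \<open>The gain of row i has order h^(1-i), a negative power for i >= 2; the weight h^i, which
  is also that of the error norm, avoids it.\<close>

lemma gain_bound:
  assumes "q \<ge> 1" "0 \<le> \<theta>" "0 < h" and small: "6 * fact (q - 1) * (\<theta> * h) \<le> 1"
    and "s > 0" "0 \<le> C" "0 \<le> \<rho>" "i \<le> q" and psd: "sym_psd (q+1) P"
    and bd: "\<And>k l. k \<le> q \<Longrightarrow> l \<le> q \<Longrightarrow> \<bar>P $$ (k,l)\<bar> \<le> C * h ^ (2*q+1-k-l)"
  shows "\<bar>gain \<rho> (predict_cov q \<theta> s h P) i\<bar> * h ^ i \<le>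
    ((16 * (real (q+1))\<^sup>2 * C + 16 * s\<^sup>2) / (s\<^sup>2 * ((1 / 2) ^ (2*q-1) / (2 * fact (q - 1))\<^sup>2))) * h"
proof -
  let ?A = "trans_mat q \<theta> h"
  define Pm where "Pm = predict_cov q \<theta> s h P"
  define D where "D = s\<^sup>2 * ((1 / 2) ^ (2*q-1) / (2 * fact (q - 1))\<^sup>2)"
  define E where "E = 16 * (real (q+1))\<^sup>2 * C + 16 * s\<^sup>2"
  note A = trans_mat_carrier[of q \<theta> h]
  have P: "P \<in> carrier_mat (q+1) (q+1)" using psd by (simp add: sym_psd_def)
  have le1: "\<theta> * h \<le> 1" using assms(2-4) by (simp add: small_step_le_1[of _ "q - 1"])
  have Pm: "Pm $$ (k,l) = (?A * P * transpose_mat ?A) $$ (k,l) + noise_mat q \<theta> s h $$ (k,l)"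
    if "k \<le> q" "l \<le> q" for k l
    unfolding Pm_def predict_cov_def using that by (subst index_add_mat(1)) (auto simp: noise_mat_def)
  have num: "\<bar>Pm $$ (i,1)\<bar> \<le> E * h ^ (2*q-i)"
  proof -
    have "\<bar>(?A * P * transpose_mat ?A) $$ (i,1)\<bar> \<le> 16 * (real (q+1))\<^sup>2 * C * h ^ (2*q+1-i-1)"
      using assms(1,2,3,6,8) le1 by (intro congruence_bound P bd) auto
    moreover have "\<bar>noise_mat q \<theta> s h $$ (i,1)\<bar> \<le> 16 * s\<^sup>2 * h ^ (2*q+1-i-1)"
      using assms(1,2,3,8) le1 by (intro noise_mat_bound) auto
    moreover have "2*q+1-i-1 = 2*q-i" by simp
    ultimately show ?thesis
      using Pm[OF assms(8,1)] unfolding E_def distrib_right by simp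
  qed
  have "0 \<le> scalar_prod (row ?A 1) (P *\<^sub>v row ?A 1)"
    using psd row_carrier[of ?A 1] A by (simp add: sym_psd_def)
  then have "0 \<le> (?A * P * transpose_mat ?A) $$ (1,1)"
    using congruence_index[OF A P, of 1 1] \<open>q \<ge> 1\<close> by simp
  then have den: "D * h ^ (2*q-1) \<le> Pm $$ (1,1)"
    using noise_mat_lower_bound[OF assms(1-4), of s] Pm[of 1 1] \<open>q \<ge> 1\<close>
    by (simp add: D_def power_divide)
  have D: "D > 0" using \<open>s > 0\<close> by (simp add: D_def)
  have E: "E \<ge> 0" using assms(6) by (simp add: E_def)
  have "\<bar>gain \<rho> Pm i\<bar> \<le> (E * h ^ (2*q-i)) / (D * h ^ (2*q-1))"
    unfolding gain_def abs_divide
  \<comment> \<open>A nonnegative measurement variance only enlarges the denominator, so the bound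
    is uniform in it.\<close>
  proof (rule frac_le)
    show "0 < D * h ^ (2*q-1)" using D assms(3) by simp
    show "D * h ^ (2*q-1) \<le> \<bar>Pm $$ (1,1) + \<rho>\<bar>" using den assms(7) by linarith
  qed (use num E assms(3) in auto)
  then have "\<bar>gain \<rho> Pm i\<bar> * h ^ i \<le> (E * h ^ (2*q-i)) / (D * h ^ (2*q-1)) * h ^ i"
    using assms(3) by (intro mult_right_mono) auto
  also have "\<dots> = E / D * (h ^ (2*q-i) * h ^ i / h ^ (2*q-1))" by simp
  also have "h ^ (2*q-i) * h ^ i = h ^ (2*q-1) * h"
  proof -
    have "2*q-i+i = Suc (2*q-1)" using assms(1,8) by simp
    then show ?thesis by (metis power_add power_Suc2)
  qed
  also have "E / D * (h ^ (2*q-1) * h / h ^ (2*q-1)) = E / D * h" using assms(3) by simp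
  finally show ?thesis by (simp add: Pm_def D_def E_def)
qed

subsection \<open>The error of one step\<close>

context
  fixes N :: "'a::euclidean_space \<Rightarrow> real"
  assumes N: "is_norm N"
begin

lemma is_norm_scale: "N (c *\<^sub>R v) = \<bar>c\<bar> * N v"
  and is_norm_triangle: "N (u + v) \<le> N u + N v"
  and is_norm_eq_0: "N v = 0 \<Longrightarrow> v = 0"
  using N by (auto simp: is_norm_def)

lemma is_norm_0 [simp]: "N 0 = 0"
  using is_norm_scale[of 0 0] by simp

lemma is_norm_nonneg: "0 \<le> N v"
  using is_norm_triangle[of v "-1 *\<^sub>R v"] is_norm_scale[of "-1" v] by simp

lemma is_norm_sum: "finite I \<Longrightarrow> N (\<Sum>i\<in>I. g i) \<le> (\<Sum>i\<in>I. N (g i))"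
  by (induction I rule: finite_induct) (auto intro: order_trans[OF is_norm_triangle])

lemma is_norm_le_norm: "N v \<le> (\<Sum>b\<in>Basis. N b) * norm v"
proof -
  have "N v = N (\<Sum>b\<in>Basis. (v \<bullet> b) *\<^sub>R b)" by (simp add: euclidean_representation)
  also have "\<dots> \<le> (\<Sum>b\<in>Basis. \<bar>v \<bullet> b\<bar> * N b)"
    using is_norm_sum[of Basis "\<lambda>b. (v \<bullet> b) *\<^sub>R b"] by (simp add: is_norm_scale)
  also have "\<dots> \<le> (\<Sum>b\<in>Basis. norm v * N b)"
    by (intro sum_mono mult_right_mono Basis_le_norm is_norm_nonneg)
  finally show ?thesis by (simp add: sum_distrib_left mult.commute)
qed

lemma continuous_on_is_norm: "continuous_on S N"
proof -
  define c where "c = (\<Sum>b\<in>Basis. N b) + 1"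
  have "c > 0" unfolding c_def by (intro add_nonneg_pos sum_nonneg is_norm_nonneg) auto
  have le: "N u - N v \<le> c * norm (u - v)" for u v
  proof -
    have "N u - N v \<le> N (u - v)" using is_norm_triangle[of "u - v" v] by simp
    also have "\<dots> \<le> c * norm (u - v)"
      using is_norm_le_norm[of "u - v"] norm_ge_zero[of "u - v"] unfolding c_def distrib_right by linarith
    finally show ?thesis .
  qed
  have "dist (N u) (N v) \<le> c * dist u v" for u v
    using le[of u v] le[of v u] by (simp add: dist_norm norm_minus_commute)
  then have "c-lipschitz_on S N" using \<open>c > 0\<close> by (intro lipschitz_onI) auto
  then show ?thesis by (rule lipschitz_on_continuous_on)
qed

text \<open>By compactness \<open>N\<close> attains a minimum on the Euclidean unit sphere, positive
  by definiteness; its inverse is the constant.\<close>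

lemma norm_le_is_norm:
  obtains a where "a > 0" "\<And>v. norm v \<le> a * N v"
proof -
  obtain b :: 'a where "b \<in> Basis" using nonempty_Basis by blast
  then have "sphere (0::'a) 1 \<noteq> {}" by (auto intro: exI[of _ b])
  then obtain u where u: "u \<in> sphere 0 1" "\<And>v. v \<in> sphere 0 1 \<Longrightarrow> N u \<le> N v"
    using continuous_attains_inf[OF compact_sphere _ continuous_on_is_norm] by blast
  have "N u \<noteq> 0" using u(1) is_norm_eq_0[of u] by auto
  then have "N u > 0" using is_norm_nonneg[of u] by simp
  have "norm v \<le> inverse (N u) * N v" for v
  proof (cases "v = 0")
    case False
    then have "N u \<le> N (inverse (norm v) *\<^sub>R v)" by (intro u(2)) simp
    also have "\<dots> = N v / norm v" by (simp add: is_norm_scale divide_inverse mult.commute)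
    finally show ?thesis using False \<open>N u > 0\<close> by (simp add: field_simps)
  qed simp
  then show ?thesis using \<open>N u > 0\<close> that[of "inverse (N u)"] by simp
qed

end

section \<open>Propagation of the error through prediction and update\<close>

text \<open>All dependence on theta is collected in one multiple of \<open>m q\<close>; the rest is
  the Taylor polynomial with the means in place of derivatives.\<close>

lemma predict_mean_split:
  assumes "i \<le> q"
  shows "predict_mean q \<theta> h m i = (\<Sum>k\<le>q-i. (h ^ k / fact k) *\<^sub>R m (i + k)) +
    (trans_mat q \<theta> h $$ (i,q) - h ^ (q - i) / fact (q - i)) *\<^sub>R m q"
proof -
  define \<delta> where "\<delta> = trans_mat q \<theta> h $$ (i,q) - h ^ (q - i) / fact (q - i)"
  have "predict_mean q \<theta> h m i = (\<Sum>k\<le>q. (if i \<le> k then (h ^ (k - i) / fact (k - i)) *\<^sub>R m k else 0)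
      + (if k = q then \<delta> *\<^sub>R m q else 0))"
    unfolding predict_mean_def
  proof (rule sum.cong)
    fix k assume "k \<in> {..q}"
    then have "k = q \<or> k < q" by auto
    then show "trans_mat q \<theta> h $$ (i,k) *\<^sub>R m k =
        (if i \<le> k then (h ^ (k - i) / fact (k - i)) *\<^sub>R m k else 0) + (if k = q then \<delta> *\<^sub>R m q else 0)"
      using assms by (auto simp: trans_mat_lower \<delta>_def scaleR_left_diff_distrib)
  qed simp
  also have "\<dots> = (\<Sum>k\<le>q. if i \<le> k then (h ^ (k - i) / fact (k - i)) *\<^sub>R m k else 0) + \<delta> *\<^sub>R m q"
    by (simp add: sum.distrib)
  also have "(\<Sum>k\<le>q. if i \<le> k then (h ^ (k - i) / fact (k - i)) *\<^sub>R m k else 0)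
      = (\<Sum>k\<in>{i..q}. (h ^ (k - i) / fact (k - i)) *\<^sub>R m k)"
    by (intro sum.mono_neutral_cong_right) auto
  also have "\<dots> = (\<Sum>k\<le>q-i. (h ^ k / fact k) *\<^sub>R m (i + k))"
    by (rule sum.reindex_bij_witness[of _ "\<lambda>k. i + k" "\<lambda>k. k - i"]) (use assms in auto)
  finally show ?thesis by (simp add: \<delta>_def)
qed

text \<open>\<open>X\<close> and \<open>Y\<close> stand for the derivatives of the exact solution at
  0 and at h. The three summands of the constant belong to the initial error, the Taylor remainder
  and the drift.\<close>

lemma predict_mean_error:
  fixes X Y m :: "nat \<Rightarrow> real^'d::finite"
  assumes "i \<le> q" "0 \<le> h" "0 \<le> \<theta>" "\<theta> * h \<le> 1" "0 \<le> B" "0 \<le> C"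
    and Taylor: "norm (Y i - (\<Sum>k\<le>q-i. (h^k / fact k) *\<^sub>R X (i + k))) \<le> B * h ^ (q + 1 - i)"
    and init: "\<And>k. k \<le> q \<Longrightarrow> norm (m k - X k) \<le> C * h ^ (q + 1 - k)"
  shows "norm (predict_mean q \<theta> h m i - Y i)
    \<le> (real (q + 1) * C + B + 3) * (1 + \<theta> * norm (m q)) * h ^ (q + 1 - i)"
proof -
  define \<delta> where "\<delta> = trans_mat q \<theta> h $$ (i,q) - h ^ (q - i) / fact (q - i)"
  define H where "H = h ^ (q + 1 - i)"
  have H: "H \<ge> 0" using assms by (simp add: H_def)
  have summand: "norm ((h ^ k / fact k) *\<^sub>R (m (i + k) - X (i + k))) \<le> C * H" if "k \<le> q - i" for k
  proof -
    have "h ^ k / fact k \<le> h ^ k / 1" using assms by (intro divide_left_mono fact_ge_1) auto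
    then have "h ^ k / fact k * norm (m (i + k) - X (i + k)) \<le> h ^ k * (C * h ^ (q + 1 - (i + k)))"
      using that assms(1,2) by (intro mult_mono init) auto
    then have "norm ((h ^ k / fact k) *\<^sub>R (m (i + k) - X (i + k))) \<le> h ^ k * (C * h ^ (q + 1 - (i + k)))"
      using assms(2) by simp
    also have "\<dots> = C * h ^ (k + (q + 1 - (i + k)))" by (simp only: power_add mult.left_commute)
    also have "k + (q + 1 - (i + k)) = q + 1 - i" using that assms by simp
    finally show ?thesis by (simp add: H_def)
  qed
  have 1: "norm (\<Sum>k\<le>q-i. (h ^ k / fact k) *\<^sub>R (m (i + k) - X (i + k))) \<le> real (q + 1) * C * H"
  proof -
    have "norm (\<Sum>k\<le>q-i. (h ^ k / fact k) *\<^sub>R (m (i + k) - X (i + k))) \<le> (\<Sum>k\<le>q-i. C * H)"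
      using summand by (intro sum_norm_le) auto
    also have "\<dots> = real (q - i + 1) * (C * H)" by simp
    also have "\<dots> \<le> real (q + 1) * (C * H)" using assms H by (intro mult_right_mono) auto
    finally show ?thesis by (simp add: mult.assoc)
  qed
  have 2: "norm (\<delta> *\<^sub>R m q) \<le> 3 * (\<theta> * H) * norm (m q)"
    using trans_mat_last_approx[OF assms(1,3,2,4)] unfolding norm_scaleR \<delta>_def H_def
    by (intro mult_right_mono) auto
  have "predict_mean q \<theta> h m i - Y i =
      (\<Sum>k\<le>q-i. (h ^ k / fact k) *\<^sub>R (m (i + k) - X (i + k))) + \<delta> *\<^sub>R m q
      - (Y i - (\<Sum>k\<le>q-i. (h^k / fact k) *\<^sub>R X (i + k)))"
    unfolding predict_mean_split[OF assms(1)] \<delta>_def scaleR_right_diff_distrib sum_subtractf by simp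
  also have "norm \<dots> \<le> real (q + 1) * C * H + 3 * (\<theta> * H) * norm (m q) + B * H"
    using norm_triangle_mono[OF norm_triangle_mono[OF 1 2] Taylor[folded H_def, unfolded norm_minus_commute[of "Y i"]]]
    by (simp add: algebra_simps)
  also have "\<dots> \<le> (real (q + 1) * C + B + 3) * (1 + \<theta> * norm (m q)) * H"
  proof -
    have "0 \<le> (real (q + 1) * C + B) * (\<theta> * norm (m q)) * H + 3 * H" using assms H by simp
    then show ?thesis by (simp add: algebra_simps)
  qed
  finally show ?thesis by (simp add: H_def)
qed

text \<open>The exact solution has zero residual, so the filter residual is controlled by the
  prediction errors of rows 0 and 1 and has order h^q; the weighted gain contributes the missing
  factor h.\<close>

lemma filter_step_error:
  fixes X Y m :: "nat \<Rightarrow> real^'d::finite"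
  assumes "i \<le> q" "q \<ge> 1" "0 < h" "h \<le> 1" "0 \<le> \<theta>" "\<theta> * h \<le> 1" "0 \<le> B" "0 \<le> C" "0 \<le> G" "0 \<le> L"
    and Taylor: "\<And>i. i \<le> q \<Longrightarrow> norm (Y i - (\<Sum>k\<le>q-i. (h^k / fact k) *\<^sub>R X (i + k))) \<le> B * h ^ (q + 1 - i)"
    and init: "\<And>k. k \<le> q \<Longrightarrow> norm (m k - X k) \<le> C * h ^ (q + 1 - k)"
    and gain: "\<And>j. \<bar>gain \<rho> (predict_cov q \<theta> (\<sigma> j) h (P j)) i\<bar> * h ^ i \<le> G * h"
    and lip: "\<And>a b. norm (f a - f b) \<le> L * norm (a - b)"
    and ode: "Y 1 = f (Y 0)"
  shows "h ^ i * norm (fst (filter_step q \<theta> \<sigma> f h \<rho> (m,P)) i - Y i)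
    \<le> (1 + G * (L + 1)) * (real (q + 1) * C + B + 3) * (1 + \<theta> * norm (m q)) * h ^ (q + 1)"
proof -
  define W where "W = (real (q + 1) * C + B + 3) * (1 + \<theta> * norm (m q))"
  define mm where "mm = predict_mean q \<theta> h m"
  define r where "r = f (mm 0) - mm 1"
  define g where "g j = gain \<rho> (predict_cov q \<theta> (\<sigma> j) h (P j)) i" for j
  have W: "W \<ge> 0" using assms by (simp add: W_def)
  have pred: "norm (mm k - Y k) \<le> W * h ^ (q + 1 - k)" if "k \<le> q" for k
    unfolding mm_def W_def using assms that by (intro predict_mean_error) auto
  have r: "norm r \<le> (L + 1) * W * h ^ q"
  proof -
    have "r = (f (mm 0) - f (Y 0)) - (mm 1 - Y 1)" using ode by (simp add: r_def)
    also have "norm \<dots> \<le> L * norm (mm 0 - Y 0) + norm (mm 1 - Y 1)"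
      by (rule order_trans[OF norm_triangle_ineq4]) (intro add_right_mono lip)
    also have "\<dots> \<le> L * (W * h ^ q) + W * h ^ q"
    proof (intro add_mono mult_left_mono)
      \<comment> \<open>Row 0 is one order better than row 1; \<open>h \<le> 1\<close> brings both
        to the common order h^q.\<close>
      have "h ^ (q + 1) \<le> h ^ q" using assms by (intro power_decreasing) auto
      then have "W * h ^ (q + 1) \<le> W * h ^ q" using W by (rule mult_left_mono)
      with pred[of 0] show "norm (mm 0 - Y 0) \<le> W * h ^ q" by simp
    qed (use pred[of 1] assms in auto)
    finally show ?thesis by (simp add: algebra_simps)
  qed
  have 1: "h ^ i * norm (mm i - Y i) \<le> W * h ^ (q + 1)"
  proof -
    have "h ^ i * norm (mm i - Y i) \<le> h ^ i * (W * h ^ (q + 1 - i))"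
      using pred assms by (intro mult_left_mono) auto
    also have "\<dots> = W * h ^ (i + (q + 1 - i))" by (simp only: power_add mult.left_commute)
    finally show ?thesis using assms by simp
  qed
  have 2: "h ^ i * norm (\<chi> j. g j * vec_nth r j) \<le> G * (L + 1) * W * h ^ (q + 1)"
  proof -
    \<comment> \<open>The gains depend on the coordinate, so the comparison is made componentwise,
      in the Euclidean norm.\<close>
    have "norm (h ^ i *\<^sub>R (\<chi> j. g j * vec_nth r j)) \<le> norm ((G * h) *\<^sub>R r)"
    proof (rule norm_le_componentwise_cart)
      fix j
      have "(\<bar>g j\<bar> * h ^ i) * \<bar>vec_nth r j\<bar> \<le> (G * h) * \<bar>vec_nth r j\<bar>"
        using gain[of j] unfolding g_def by (intro mult_right_mono) auto
      then show "norm (vec_nth (h ^ i *\<^sub>R (\<chi> j. g j * vec_nth r j)) j) \<le> norm (vec_nth ((G * h) *\<^sub>R r) j)"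
        using assms by (simp add: abs_mult mult_ac)
    qed
    also have "\<dots> \<le> G * h * ((L + 1) * W * h ^ q)"
      using r assms by (simp add: abs_mult mult_left_mono)
    finally show ?thesis using assms by (simp add: mult_ac)
  qed
  have "fst (filter_step q \<theta> \<sigma> f h \<rho> (m,P)) i = mm i + (\<chi> j. g j * vec_nth r j)"
    by (simp add: filter_step_def Let_def mm_def r_def g_def Finite_Cartesian_Product.vec_eq_iff)
  then have "fst (filter_step q \<theta> \<sigma> f h \<rho> (m,P)) i - Y i = (mm i - Y i) + (\<chi> j. g j * vec_nth r j)"
    by simp
  then have le: "norm (fst (filter_step q \<theta> \<sigma> f h \<rho> (m,P)) i - Y i)
      \<le> norm (mm i - Y i) + norm (\<chi> j. g j * vec_nth r j)"
    by (simp only: norm_triangle_ineq)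
  have "h ^ i * norm (fst (filter_step q \<theta> \<sigma> f h \<rho> (m,P)) i - Y i)
      \<le> h ^ i * norm (mm i - Y i) + h ^ i * norm (\<chi> j. g j * vec_nth r j)"
    using mult_left_mono[OF le, of "h ^ i"] assms(3) by (simp add: distrib_left)
  also have "\<dots> \<le> W * h ^ (q + 1) + G * (L + 1) * W * h ^ (q + 1)" using 1 2 by (rule add_mono)
  also have "\<dots> = (1 + G * (L + 1)) * W * h ^ (q + 1)" by (simp add: distrib_right)
  finally show ?thesis by (simp add: W_def mult.assoc)
qed

section \<open>Choice of constants and conclusion\<close>

text \<open>Reads the Lipschitz condition at the zero multi-index as one on f itself.\<close>

lemma multi_deriv_zero: "multi_deriv (\<lambda>_. 0) f = f"
proof -
  have "foldr (\<lambda>j. partial_deriv j ^^ 0) xs f = f" for xs :: "'a list"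
    by (induction xs) auto
  then show ?thesis by (simp add: multi_deriv_def)
qed

theorem theorem8:
  fixes q :: nat and T L K0 :: real
    and N :: "real^'d::{finite,linorder} \<Rightarrow> real"
    and f :: "real^'d::_ \<Rightarrow> real^'d::_"
    and x :: "real \<Rightarrow> real^'d::_" and x0 :: "real^'d::_"
    and \<sigma> :: "'d \<Rightarrow> real"
  assumes "q \<ge> 1" and "T > 0" and "is_norm N"
    and "\<And>j. \<sigma> j > 0"
    and A1_smooth: "Ck q f"
    and A1_L: "L > 0"
    and A1_bounded: "\<And>\<alpha> a. 1 \<le> (\<Sum>i\<in>UNIV. \<alpha> i) \<Longrightarrow> (\<Sum>i\<in>UNIV. \<alpha> i) \<le> q \<Longrightarrow>
          N (multi_deriv \<alpha> f a) \<le> L"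
    and A1_Lipschitz: "\<And>\<alpha> a b. (\<Sum>i\<in>UNIV. \<alpha> i) \<le> q \<Longrightarrow>
          N (multi_deriv \<alpha> f a - multi_deriv \<alpha> f b) \<le> L * N (a - b)"
    and ode: "\<And>t. t \<in> {0..T} \<Longrightarrow> (x has_vector_derivative f (x t)) (at t within {0..T})"
    and init: "x 0 = x0"
    and "K0 > 0"
  shows "\<exists>K>0. \<forall>\<theta>\<ge>0. \<forall>\<^sub>F h in at_right 0.
     \<forall>R m0 P0.
       (\<forall>t. R t \<ge> 0) \<longrightarrow>
       (\<forall>j. sym_psd (q+1) (P0 j)) \<longrightarrow>
       (\<forall>k\<le>q. \<forall>l\<le>q. N (\<chi> j. P0 j $$ (k,l)) \<le> K0 * h ^ (2*q+1-k-l)) \<longrightarrow>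
       (\<forall>i\<le>q. N (m0 i - time_deriv T i x 0) \<le> K0 * h ^ (q+1-i)) \<longrightarrow>
       N (filter_error q \<theta> \<sigma> f R h (m0,P0) T x 1 0)
         \<le> h_norm q N h (filter_error q \<theta> \<sigma> f R h (m0,P0) T x 1) \<and>
       h_norm q N h (filter_error q \<theta> \<sigma> f R h (m0,P0) T x 1)
         \<le> K * (1 + \<theta> * N (m0 q)) * h ^ (q+1)"
proof -
  note N = \<open>is_norm N\<close>
  note nonneg = is_norm_nonneg[OF N]
  obtain a where a: "a > 0" "\<And>v. norm v \<le> a * N v" by (rule norm_le_is_norm[OF N]) blast
  \<comment> \<open>The summand 1 makes \<open>b\<close>, and with it the final constant, visibly
    positive.\<close>
  define b where "b = (\<Sum>e\<in>Basis. N e) + 1"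
  have b: "b > 0" unfolding b_def by (intro add_nonneg_pos sum_nonneg nonneg) auto
  have N_le: "N v \<le> b * norm v" for v
    using is_norm_le_norm[OF N, of v] norm_ge_zero[of v] unfolding b_def distrib_right by linarith
  define L' where "L' = a * L * b"
  have L': "0 \<le> L'" using a b A1_L by (simp add: L'_def)
  have lip: "norm (f u - f v) \<le> L' * norm (u - v)" for u v
  proof -
    have "norm (f u - f v) \<le> a * N (f u - f v)" by (rule a)
    also have "\<dots> \<le> a * (L * N (u - v))"
      using A1_Lipschitz[of "\<lambda>_. 0" u v] a by (simp add: multi_deriv_zero)
    also have "\<dots> \<le> a * (L * (b * norm (u - v)))"
      using a A1_L N_le by (intro mult_left_mono) auto
    finally show ?thesis by (simp add: L'_def mult.assoc)
  qed
  have x_diff: "diff_on T (Suc q) x" by (rule ode_solution_diff_on[OF ode A1_smooth])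
  \<comment> \<open>The derivative of order q+1 is continuous on a compact interval; its bound
    \<open>B\<close> depends on x, q and T only.\<close>
  have "diff_on T 0 (time_deriv T (Suc q) x)"
    using time_deriv_diff_on[OF \<open>T > 0\<close>, of "Suc q" 0 x] x_diff by (simp del: diff_on.simps)
  then have "bounded (time_deriv T (Suc q) x ` {0..T})"
    by (intro compact_imp_bounded compact_continuous_image) auto
  then obtain B where B: "B > 0" "\<And>t. t \<in> {0..T} \<Longrightarrow> norm (time_deriv T (Suc q) x t) \<le> B"
    unfolding bounded_pos by auto
  have ode': "time_deriv T 1 x t = f (time_deriv T 0 x t)" if "t \<in> {0..T}" for t
    using vector_derivative_within_cbox[of 0 T t x "f (x t)"] ode[OF that] that \<open>T > 0\<close>
    by (simp add: time_deriv_Suc)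
  define C where "C = a * K0"
  have C: "C > 0" using a \<open>K0 > 0\<close> by (simp add: C_def)
  \<comment> \<open>The constant of \<open>gain_bound\<close> for coordinate j, free of theta and h;
    the sum \<open>Gs\<close> dominates all coordinates at once.\<close>
  define G where "G j = (16 * (real (q+1))\<^sup>2 * C + 16 * (\<sigma> j)\<^sup>2) /
      ((\<sigma> j)\<^sup>2 * ((1 / 2) ^ (2*q-1) / (2 * fact (q - 1))\<^sup>2))" for j
  have G0: "G j \<ge> 0" for j using C by (simp add: G_def)
  define Gs where "Gs = (\<Sum>j\<in>UNIV. G j)"
  have Gs: "Gs \<ge> 0" "G j \<le> Gs" for j
    unfolding Gs_def using G0 by (auto intro!: sum_nonneg member_le_sum)
  define M where "M = (1 + Gs * (L' + 1)) * (real (q + 1) * C + B + 3)"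
  have "1 + Gs * (L' + 1) > 0" using Gs L' by (intro add_pos_nonneg) auto
  moreover have "real (q + 1) * C + B + 3 > 0" using C B by (intro add_pos_pos) auto
  ultimately have M: "M > 0" by (simp add: M_def)
  \<comment> \<open>q+1 rows are summed, \<open>b\<close> converts the error back to
    \<open>N\<close>, and 1 + a pays for replacing the Euclidean norm of \<open>m0 q\<close> by
    \<open>N (m0 q)\<close>.\<close>
  define K where "K = real (q + 1) * b * M * (1 + a)"
  have "K > 0" using a b M by (simp add: K_def)
  moreover have "\<forall>\<^sub>F h in at_right 0.
     \<forall>R m0 P0.
       (\<forall>t. R t \<ge> 0) \<longrightarrow>
       (\<forall>j. sym_psd (q+1) (P0 j)) \<longrightarrow>
       (\<forall>k\<le>q. \<forall>l\<le>q. N (\<chi> j. P0 j $$ (k,l)) \<le> K0 * h ^ (2*q+1-k-l)) \<longrightarrow>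
       (\<forall>i\<le>q. N (m0 i - time_deriv T i x 0) \<le> K0 * h ^ (q+1-i)) \<longrightarrow>
       N (filter_error q \<theta> \<sigma> f R h (m0,P0) T x 1 0)
         \<le> h_norm q N h (filter_error q \<theta> \<sigma> f R h (m0,P0) T x 1) \<and>
       h_norm q N h (filter_error q \<theta> \<sigma> f R h (m0,P0) T x 1)
         \<le> K * (1 + \<theta> * N (m0 q)) * h ^ (q+1)"
    if \<theta>: "\<theta> \<ge> 0" for \<theta>
    unfolding eventually_at_right_field
  \<comment> \<open>The three bounds give h <= 1, h in [0,T] and the smallness of theta * h; theta +
    1 keeps the quotient meaningful for theta = 0.\<close>
  proof (intro exI[of _ "min 1 (min T (1 / (6 * fact (q - 1) * (\<theta> + 1))))"] conjI allI impI)
    show "0 < min 1 (min T (1 / (6 * fact (q - 1) * (\<theta> + 1))))" using \<open>T > 0\<close> \<theta> by simp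
  next
    fix h :: real and R :: "real \<Rightarrow> real" and m0 :: "nat \<Rightarrow> real^'d::_" and P0 :: "'d \<Rightarrow> real mat"
    assume h: "0 < h" "h < min 1 (min T (1 / (6 * fact (q - 1) * (\<theta> + 1))))"
      and R: "\<forall>t. 0 \<le> R t" and psd: "\<forall>j. sym_psd (q+1) (P0 j)"
      and P0: "\<forall>k\<le>q. \<forall>l\<le>q. N (\<chi> j. P0 j $$ (k,l)) \<le> K0 * h ^ (2*q+1-k-l)"
      and m0: "\<forall>i\<le>q. N (m0 i - time_deriv T i x 0) \<le> K0 * h ^ (q+1-i)"
    let ?e = "filter_error q \<theta> \<sigma> f R h (m0,P0) T x 1"
    have "h * (6 * fact (q - 1) * (\<theta> + 1)) \<le> 1" using h \<theta> by (simp add: pos_less_divide_eq)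
    moreover have "0 \<le> 6 * fact (q - 1) * h" using h by simp
    ultimately have small: "6 * fact (q - 1) * (\<theta> * h) \<le> 1" by (simp add: algebra_simps)
    have le1: "\<theta> * h \<le> 1" using small_step_le_1[OF _ small] \<theta> h by simp
    have gain: "\<bar>gain (R h) (predict_cov q \<theta> (\<sigma> j) h (P0 j)) i\<bar> * h ^ i \<le> Gs * h" if "i \<le> q" for i j
    proof -
      have bd: "\<bar>P0 j $$ (k,l)\<bar> \<le> C * h ^ (2*q+1-k-l)" if "k \<le> q" "l \<le> q" for k l
      proof -
        have "\<bar>P0 j $$ (k,l)\<bar> \<le> norm (\<chi> j. P0 j $$ (k,l))"
          using component_le_norm_cart[of "\<chi> j. P0 j $$ (k,l)" j] by simp
        also have "\<dots> \<le> a * N (\<chi> j. P0 j $$ (k,l))" by (rule a)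
        also have "\<dots> \<le> a * (K0 * h ^ (2*q+1-k-l))" using P0 that a by (intro mult_left_mono) auto
        finally show ?thesis by (simp add: C_def mult.assoc)
      qed
      have "\<bar>gain (R h) (predict_cov q \<theta> (\<sigma> j) h (P0 j)) i\<bar> * h ^ i \<le> G j * h"
        unfolding G_def using psd R C h \<theta> small that assms(1,4) bd by (intro gain_bound) auto
      also have "\<dots> \<le> Gs * h" using Gs h by (intro mult_right_mono) auto
      finally show ?thesis .
    qed
    have err: "h ^ i * norm (?e i) \<le> M * (1 + \<theta> * norm (m0 q)) * h ^ (q + 1)" if "i \<le> q" for i
    proof -
      have "h ^ i * norm (fst (filter_step q \<theta> \<sigma> f h (R h) (m0,P0)) i - time_deriv T i x h)
        \<le> (1 + Gs * (L' + 1)) * (real (q + 1) * C + B + 3) * (1 + \<theta> * norm (m0 q)) * h ^ (q + 1)"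
      proof (rule filter_step_error[where Y = "\<lambda>i. time_deriv T i x h" and X = "\<lambda>i. time_deriv T i x 0"])
        fix k assume "k \<le> q"
        then show "norm (time_deriv T k x h - (\<Sum>l\<le>q-k. (h^l / fact l) *\<^sub>R time_deriv T (k + l) x 0))
            \<le> B * h ^ (q + 1 - k)"
          using B h \<open>T > 0\<close> x_diff by (intro time_deriv_Taylor_bound) auto
      next
        fix k assume k: "k \<le> q"
        have "norm (m0 k - time_deriv T k x 0) \<le> a * N (m0 k - time_deriv T k x 0)" by (rule a)
        also have "\<dots> \<le> a * (K0 * h ^ (q + 1 - k))" using m0 k a by (intro mult_left_mono) auto
        finally show "norm (m0 k - time_deriv T k x 0) \<le> C * h ^ (q + 1 - k)"
          by (simp add: C_def mult.assoc)
      next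
        show "time_deriv T 1 x h = f (time_deriv T 0 x h)" using h by (intro ode') auto
      qed (use that assms(1) h \<theta> le1 B C Gs L' lip gain in auto)
      then show ?thesis by (simp add: filter_error_def M_def)
    qed
    have "1 + \<theta> * norm (m0 q) \<le> (1 + a) * (1 + \<theta> * N (m0 q))"
    proof -
      have "\<theta> * norm (m0 q) \<le> \<theta> * (a * N (m0 q))" using a \<theta> by (intro mult_left_mono) auto
      moreover have "0 \<le> a + \<theta> * N (m0 q)" using a \<theta> nonneg by simp
      ultimately show ?thesis by (simp add: algebra_simps)
    qed
    then have "b * (M * (1 + \<theta> * norm (m0 q)) * h ^ (q + 1))
        \<le> b * (M * ((1 + a) * (1 + \<theta> * N (m0 q))) * h ^ (q + 1))"
      using b M h by (intro mult_left_mono mult_right_mono) auto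
    moreover have "h ^ i * N (?e i) \<le> b * (M * (1 + \<theta> * norm (m0 q)) * h ^ (q + 1))" if "i \<le> q" for i
    proof -
      have "h ^ i * N (?e i) \<le> h ^ i * (b * norm (?e i))"
        using N_le h by (intro mult_left_mono) auto
      also have "\<dots> \<le> b * (M * (1 + \<theta> * norm (m0 q)) * h ^ (q + 1))"
        using mult_left_mono[OF err[OF that], of b] b by (simp add: mult_ac)
      finally show ?thesis .
    qed
    ultimately have "h_norm q N h ?e \<le> (\<Sum>i\<le>q. b * (M * ((1 + a) * (1 + \<theta> * N (m0 q))) * h ^ (q + 1)))"
      unfolding h_norm_def by (intro sum_mono) force
    then show "h_norm q N h ?e \<le> K * (1 + \<theta> * N (m0 q)) * h ^ (q + 1)"
      by (simp add: K_def mult_ac)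
    have "h ^ 0 * N (?e 0) \<le> (\<Sum>i\<le>q. h ^ i * N (?e i))"
      by (rule member_le_sum) (use h nonneg in auto)
    then show "N (?e 0) \<le> h_norm q N h ?e" by (simp add: h_norm_def)
  qed
  ultimately show ?thesis by blast
qed

end
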